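(* Let $p,q$ be distinct odd primes and $\alpha,\beta$ positive integers. Then $$\sum_{\substack{i+j+k=2p^{\alpha}q^{\beta}\\ i,j,k\in\mathcal{P}_{pq}}}\frac{(-1)^{i}}{ijk}\equiv-\frac{1}{2}Z(p^{\alpha}q^{\beta})\equiv (q-2)\Bigl(1-\frac{1}{q^{3}}\Bigr)p^{\alpha-1}q^{\beta-1}B_{p-3}\pmod{p^{\alpha}}.$$
   Context: For a positive integer $n$, $\mathcal{P}_n$ denotes the set of positive integers coprime to $n$, and $Z(n)=\sum_{i+j+k=n,\ i,j,k\in\mathcal{P}_n}\frac{1}{ijk}$. All sums are over ordered triples $(i,j,k)$ of positive integers. The Bernoulli numbers $B_k$ are defined by $B_0=1$ and $\sum_{i=0}^{n}\binom{n+1}{i}B_i=0$ for $n\ge1$. A congruence between rational numbers modulo $p^{\alpha}$ means that the difference, written in lowest terms, has numerator divisible by $p^{\alpha}$ and denominator coprime to $p$. *)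

theory Defs
  imports "HOL-Number_Theory.Number_Theory"
begin

definition coprimes :: "nat \<Rightarrow> nat set" where
  "coprimes n = {m. 0 < m \<and> coprime m n}"

definition coprime_triples :: "nat \<Rightarrow> nat \<Rightarrow> (nat \<times> nat \<times> nat) set" where
  "coprime_triples N n =
     {(i, j, k). i + j + k = N \<and> i \<in> coprimes n \<and> j \<in> coprimes n \<and> k \<in> coprimes n}"

lemma finite_coprime_triples [simp]: "finite (coprime_triples N n)"
proof (rule finite_subset)
  show "coprime_triples N n \<subseteq> {..N} \<times> {..N} \<times> {..N}"
    by (auto simp: coprime_triples_def)
qed simp

definition Z :: "nat \<Rightarrow> rat" where
  "Z n = (\<Sum>(i, j, k)\<in>coprime_triples n n. 1 / (of_nat i * of_nat j * of_nat k))"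

(* The defining relation of the Bernoulli numbers (lemma bernoulli_recurrence) solved for its
   last term; this gives B_1 = -1/2. *)
fun bernoulli :: "nat \<Rightarrow> rat" where
  "bernoulli 0 = 1"
| "bernoulli (Suc n) =
     - (\<Sum>i\<le>n. of_nat (Suc (Suc n) choose i) * bernoulli i) / of_nat (Suc (Suc n))"

lemma bernoulli_recurrence:
  assumes "n \<ge> 1"
  shows "(\<Sum>i=0..n. of_nat ((n + 1) choose i) * bernoulli i) = 0"
proof -
  obtain m where n: "n = Suc m"
    using assms by (cases n) auto
  have "(of_nat (Suc (Suc m)) :: rat) \<noteq> 0"
    by (simp only: of_nat_eq_0_iff)
  then show ?thesis
    unfolding n atLeast0AtMost
    by (simp add: binomial_Suc_n del: binomial_Suc_Suc of_nat_Suc)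
qed

(* quotient_of yields the representation in lowest terms, with positive denominator. *)
definition rat_cong :: "nat \<Rightarrow> nat \<Rightarrow> rat \<Rightarrow> rat \<Rightarrow> bool" where
  "rat_cong p a x y \<longleftrightarrow>
     (case quotient_of (x - y) of (num, den) \<Rightarrow> int (p ^ a) dvd num \<and> coprime den (int p))"

end

theory Submission
  imports Defs
begin

text \<open>
  Write \<open>T(N)\<close> for the sum of \<open>1/(i j k)\<close> over \<open>i + j + k = N\<close>. Splitting each summand as a
  residue modulo \<open>n\<close> plus a multiple of \<open>n\<close> and expanding \<open>1/(a + n x)\<close> to first order gives
  \<open>T(m n) \<equiv> m T(n) - K n W(n)\<close> modulo the square of the \<open>p\<close>-part of \<open>n\<close>, where
  \<open>3 K = m (m\<^sup>2 - 1)\<close> and \<open>W(n)\<close> is the sum of \<open>(1/i + 1/j + 1/k)/(i j k)\<close>.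
  A parity argument expresses three times the alternating sum as \<open>Z(n)/2 - T(2 n)\<close>, so \<open>m = 2\<close>
  settles the first congruence; for \<open>p = 3\<close> the lost factor 3 is regained from
  \<open>W(n) \<equiv> 0\<close> modulo 3. With \<open>m = p\<close> and \<open>m = q\<close> the second congruence reduces to
  \<open>\<alpha> = \<beta> = 1\<close>, that is, to a congruence modulo \<open>p\<close>.

  There inclusion-exclusion over divisibility by \<open>q\<close> leaves \<open>T(p)\<close> and the sum \<open>G\<close> over the
  triples with \<open>q\<close> dividing \<open>i\<close>. Modulo \<open>p\<close>, \<open>G\<close> splits into power sums, evaluated by
  Faulhaber's formula, and the sum of \<open>i\<^sup>-\<^sup>3 \<lfloor>q i / p\<rfloor>\<close>, evaluated by a congruence of
  Voronoi; the case \<open>q = 1\<close> of the same computation yields \<open>T(p) \<equiv> -2 B_{p-3}\<close>.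
\<close>

subsection \<open>Congruences between rationals\<close>

text \<open>For prime \<open>p\<close> this is the localization of the integers at \<open>p\<close>.
  The fraction need not be in lowest terms, which makes closure under sums and products
  immediate.\<close>

definition p_integral :: "nat \<Rightarrow> rat set" where
  "p_integral p = {of_int u / of_int d | u d. coprime d (int p)}"

lemma p_integralI: "x = of_int u / of_int d \<Longrightarrow> coprime d (int p) \<Longrightarrow> x \<in> p_integral p"
  unfolding p_integral_def by blast

locale prime_modulus =
  fixes p :: nat
  assumes prime_p: "prime p"
begin

lemma coprime_nonzero: "coprime d (int p) \<Longrightarrow> d \<noteq> 0"
  using prime_p by (auto simp: prime_nat_iff coprime_int_iff[of 0, simplified])

lemma p_integral_of_int [simp, intro]: "of_int u \<in> p_integral p"
  by (rule p_integralI[of _ u 1]) auto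

lemma p_integral_of_nat [simp, intro]: "of_nat u \<in> p_integral p"
  using p_integral_of_int[of "int u"] by simp

lemma p_integral_numeral [simp, intro]: "numeral u \<in> p_integral p"
  using p_integral_of_int[of "numeral u"] by simp

lemma p_integral_neg_numeral [simp, intro]: "- numeral u \<in> p_integral p"
  using p_integral_of_int[of "- numeral u"] by simp

lemma p_integral_minus_1 [simp, intro]: "- 1 \<in> p_integral p"
  using p_integral_of_int[of "- 1"] by simp

lemma p_integral_0 [simp, intro]: "0 \<in> p_integral p"
  using p_integral_of_int[of 0] by simp

lemma p_integral_1 [simp, intro]: "1 \<in> p_integral p"
  using p_integral_of_int[of 1] by simp

lemma p_integral_add [intro]:
  assumes "x \<in> p_integral p" "y \<in> p_integral p"
  shows "x + y \<in> p_integral p"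
proof -
  obtain u d v e where "coprime d (int p)" "x = of_int u / of_int d"
    "coprime e (int p)" "y = of_int v / of_int e"
    using assms unfolding p_integral_def by auto
  moreover from this have "d \<noteq> 0" "e \<noteq> 0" using coprime_nonzero by auto
  ultimately have "x + y = of_int (u * e + v * d) / of_int (d * e)" "coprime (d * e) (int p)"
    by (auto simp: field_simps)
  then show ?thesis unfolding p_integral_def by blast
qed

lemma p_integral_mult [intro]:
  assumes "x \<in> p_integral p" "y \<in> p_integral p"
  shows "x * y \<in> p_integral p"
proof -
  obtain u d v e where "coprime d (int p)" "x = of_int u / of_int d"
    "coprime e (int p)" "y = of_int v / of_int e"
    using assms unfolding p_integral_def by auto
  then have "x * y = of_int (u * v) / of_int (d * e)" "coprime (d * e) (int p)"
    by auto
  then show ?thesis unfolding p_integral_def by blast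
qed

lemma p_integral_uminus [intro]: "x \<in> p_integral p \<Longrightarrow> - x \<in> p_integral p"
  using p_integral_mult[of "of_int (-1)" x, OF p_integral_of_int] by simp

lemma p_integral_diff [intro]:
  "x \<in> p_integral p \<Longrightarrow> y \<in> p_integral p \<Longrightarrow> x - y \<in> p_integral p"
  using p_integral_add[of x "- y"] by auto

lemma p_integral_power [intro]: "x \<in> p_integral p \<Longrightarrow> x ^ n \<in> p_integral p"
  by (induction n) auto

lemma p_integral_sum [intro]:
  "(\<And>x. x \<in> A \<Longrightarrow> f x \<in> p_integral p) \<Longrightarrow> sum f A \<in> p_integral p"
  by (induction A rule: infinite_finite_induct) auto

lemma coprime_int_p: "\<not> p dvd n \<Longrightarrow> coprime (int n) (int p)"
  using prime_imp_coprime[OF prime_p] by (simp add: coprime_commute)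

lemma p_integral_divide [intro]:
  assumes "x \<in> p_integral p" "\<not> p dvd n"
  shows "x / of_nat n \<in> p_integral p"
proof -
  have "1 / of_nat n \<in> p_integral p"
    by (rule p_integralI[OF _ coprime_int_p[OF assms(2)], of _ 1]) auto
  from p_integral_mult[OF assms(1) this] show ?thesis by simp
qed

lemma p_integral_inverse: "\<not> p dvd n \<Longrightarrow> 1 / of_nat n \<in> p_integral p"
  using p_integral_divide[OF p_integral_1] .

text \<open>Trades lowest terms for arithmetic in the local ring; later congruences are handled
  through the witness \<open>z\<close>.\<close>

lemma rat_cong_iff: "rat_cong p a x y \<longleftrightarrow> (\<exists>z\<in>p_integral p. x - y = of_nat p ^ a * z)"
proof
  obtain u d where ud: "quotient_of (x - y) = (u, d)" by fastforce
  note d_pos = quotient_of_denom_pos[OF ud] and cop = quotient_of_coprime[OF ud]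
    and xy = quotient_of_div[OF ud]
  {
    assume "rat_cong p a x y"
    then obtain k where "u = int (p ^ a) * k" "coprime d (int p)"
      unfolding rat_cong_def ud by auto
    then show "\<exists>z\<in>p_integral p. x - y = of_nat p ^ a * z"
      using xy by (intro bexI[of _ "of_int k / of_int d"]) (auto intro: p_integralI)
  next
    assume "\<exists>z\<in>p_integral p. x - y = of_nat p ^ a * z"
    then obtain v e where e: "coprime e (int p)" and "x - y = of_nat p ^ a * (of_int v / of_int e)"
      unfolding p_integral_def by blast
    moreover have "e \<noteq> 0" using e coprime_nonzero by auto
    ultimately have "of_int (u * e) = (of_int (int (p ^ a) * v * d) :: rat)"
      using xy d_pos by (auto simp: field_simps)
    then have eq: "u * e = int (p ^ a) * v * d" by (simp only: of_int_eq_iff)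
    \<comment> \<open>\<open>d\<close> divides \<open>u * e\<close> and is prime to
      \<open>u\<close>. The same cancellation, with \<open>p ^ a\<close> prime to \<open>e\<close>,
      then shows that \<open>p ^ a\<close> divides \<open>u\<close>.\<close>
    have "d dvd e" using eq cop
      by (metis coprime_commute coprime_dvd_mult_right_iff dvd_triv_right)
    then have "coprime d (int p)" using e by (meson coprime_divisors dvd_refl)
    moreover have "coprime (int (p ^ a)) e" using e by (simp add: coprime_commute)
    then have "int (p ^ a) dvd u" using eq
      by (metis coprime_dvd_mult_left_iff dvd_triv_left mult.assoc)
    ultimately show "rat_cong p a x y" unfolding rat_cong_def ud by auto
  }
qed

lemma rat_congI: "z \<in> p_integral p \<Longrightarrow> x - y = of_nat p ^ a * z \<Longrightarrow> rat_cong p a x y"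
  unfolding rat_cong_iff by blast

lemma rat_congE:
  assumes "rat_cong p a x y"
  obtains z where "z \<in> p_integral p" "x = y + of_nat p ^ a * z"
  using assms unfolding rat_cong_iff by (auto simp: algebra_simps)

lemma rat_cong_refl [simp, intro]: "rat_cong p a x x"
  by (rule rat_congI[of 0]) auto

lemma rat_cong_sym: "rat_cong p a x y \<Longrightarrow> rat_cong p a y x"
proof -
  assume "rat_cong p a x y"
  then obtain z where "z \<in> p_integral p" "x = y + of_nat p ^ a * z" by (metis rat_congE)
  then show ?thesis by (intro rat_congI[of "- z"]) auto
qed

lemma rat_cong_add:
  assumes "rat_cong p a x y" "rat_cong p a x' y'"
  shows "rat_cong p a (x + x') (y + y')"
proof -
  from assms obtain z z' where "z \<in> p_integral p" "x = y + of_nat p ^ a * z"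
    "z' \<in> p_integral p" "x' = y' + of_nat p ^ a * z'" by (metis rat_congE)
  then show ?thesis by (intro rat_congI[of "z + z'"]) (auto simp: algebra_simps)
qed

lemma rat_cong_mult_left:
  assumes "rat_cong p a x y" "c \<in> p_integral p"
  shows "rat_cong p a (c * x) (c * y)"
proof -
  from assms obtain z where "z \<in> p_integral p" "x = y + of_nat p ^ a * z" by (metis rat_congE)
  then show ?thesis using assms(2) by (intro rat_congI[of "c * z"]) (auto simp: algebra_simps)
qed

lemma rat_cong_mult_right:
  "rat_cong p a x y \<Longrightarrow> c \<in> p_integral p \<Longrightarrow> rat_cong p a (x * c) (y * c)"
  using rat_cong_mult_left[of a x y c] by (simp add: mult.commute)

lemma rat_cong_trans [trans]:
  assumes "rat_cong p a x y" "rat_cong p a y z"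
  shows "rat_cong p a x z"
  using rat_cong_add[OF assms] by (simp add: rat_cong_iff)

lemma rat_cong_uminus: "rat_cong p a x y \<Longrightarrow> rat_cong p a (- x) (- y)"
  using rat_cong_mult_left[of a x y "-1", OF _ p_integral_uminus[OF p_integral_1]] by simp

lemma rat_cong_diff:
  "rat_cong p a x y \<Longrightarrow> rat_cong p a x' y' \<Longrightarrow> rat_cong p a (x - x') (y - y')"
  using rat_cong_add[OF _ rat_cong_uminus] by fastforce

text \<open>From \<open>x * x' - y * y' = (x - y) * x' + y * (x' - y')\<close>; hence integrality is
  asked of \<open>x'\<close> and \<open>y\<close>.\<close>

lemma rat_cong_mult:
  assumes "rat_cong p a x y" "rat_cong p a x' y'" "x' \<in> p_integral p" "y \<in> p_integral p"
  shows "rat_cong p a (x * x') (y * y')"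
  using rat_cong_trans[OF rat_cong_mult_right rat_cong_mult_left] assms by blast

lemma rat_cong_sum:
  "(\<And>i. i \<in> A \<Longrightarrow> rat_cong p a (f i) (g i)) \<Longrightarrow> rat_cong p a (sum f A) (sum g A)"
  by (induction A rule: infinite_finite_induct) (auto intro!: rat_cong_add)

lemma rat_cong_mono:
  assumes "rat_cong p b x y" "a \<le> b"
  shows "rat_cong p a x y"
proof -
  from assms obtain z where "z \<in> p_integral p" "x = y + of_nat p ^ b * z" by (metis rat_congE)
  then show ?thesis using assms(2)
    by (intro rat_congI[of "of_nat p ^ (b - a) * z"]) (auto simp flip: mult.assoc power_add)
qed

lemma rat_cong_scale:
  assumes "rat_cong p a x y"
  shows "rat_cong p (a + b) (of_nat p ^ b * x) (of_nat p ^ b * y)"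
proof -
  from assms obtain z where "z \<in> p_integral p" "x = y + of_nat p ^ a * z" by (metis rat_congE)
  then show ?thesis by (intro rat_congI[of z]) (auto simp: power_add algebra_simps)
qed

text \<open>Cancelling \<open>p ^ b\<close> costs \<open>b\<close> in the exponent of the modulus,
  in contrast to \<open>rat_cong_cancel\<close>, where the cancelled factor is a unit.\<close>

lemma rat_cong_unscale:
  assumes "rat_cong p (a + b) (of_nat p ^ b * x) (of_nat p ^ b * y)"
  shows "rat_cong p a x y"
proof -
  from assms obtain z where z: "z \<in> p_integral p"
    "of_nat p ^ b * x = of_nat p ^ b * y + of_nat p ^ (a + b) * z" by (metis rat_congE)
  then have "of_nat p ^ b * x = of_nat p ^ b * (y + of_nat p ^ a * z)"
    by (simp add: power_add algebra_simps)
  moreover have "(of_nat p ^ b :: rat) \<noteq> 0"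
    using prime_p by auto
  ultimately have "x = y + of_nat p ^ a * z" by (metis mult_left_cancel)
  then show ?thesis using z by (intro rat_congI[of z]) auto
qed

lemma rat_cong_cancel:
  assumes "rat_cong p a (of_nat n * x) (of_nat n * y)" "\<not> p dvd n"
  shows "rat_cong p a x y"
proof -
  have "n \<noteq> 0" using assms(2) by (intro notI) simp
  with rat_cong_mult_left[OF assms(1) p_integral_inverse[OF assms(2)]] show ?thesis
    by simp
qed

lemma rat_cong_0I: "x \<in> p_integral p \<Longrightarrow> rat_cong p a (of_nat p ^ a * x) 0"
  by (rule rat_congI) auto

lemma rat_cong_of_nat: "[m = n] (mod p ^ a) \<Longrightarrow> rat_cong p a (of_nat m) (of_nat n)"
proof -
  assume "[m = n] (mod p ^ a)"
  then have "[int m = int n] (mod int (p ^ a))" by (simp only: cong_int_iff)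
  then obtain k where "int m - int n = int (p ^ a) * k"
    by (auto simp: cong_iff_dvd_diff)
  then have "(of_int (int m - int n) :: rat) = of_int (int (p ^ a) * k)" by simp
  then show ?thesis by (intro rat_congI[of "of_int k"]) auto
qed

lemma rat_cong_inverse:
  assumes "rat_cong p a (of_nat m) (of_nat n)" "\<not> p dvd m" "\<not> p dvd n"
  shows "rat_cong p a (1 / of_nat m) (1 / of_nat n)"
proof -
  have nz: "m \<noteq> 0" "n \<noteq> 0" using assms(2,3) by (auto intro!: Nat.gr0I)
  have "rat_cong p a (1 / of_nat m * (1 / of_nat n) * of_nat m)
      (1 / of_nat m * (1 / of_nat n) * of_nat n)"
    by (rule rat_cong_mult_left[OF assms(1)]) (intro p_integral_mult p_integral_inverse assms)
  then show ?thesis using nz by (simp add: rat_cong_sym)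
qed

end

subsection \<open>Bernoulli numbers and power sums\<close>

lemma sum_triangle_swap:
  fixes g :: "nat \<Rightarrow> nat \<Rightarrow> 'a::comm_monoid_add"
  shows "(\<Sum>k\<le>m. \<Sum>l\<le>m - k. g k l) = (\<Sum>l\<le>m. \<Sum>k\<le>m - l. g k l)"
proof -
  have "(\<Sum>k\<le>m. \<Sum>l\<le>m - k. g k l) = (\<Sum>(k, l)\<in>(SIGMA k:{..m}. {..m - k}). g k l)"
    by (simp add: sum.Sigma)
  also have "\<dots> = (\<Sum>(l, k)\<in>(SIGMA l:{..m}. {..m - l}). g k l)"
    by (rule sum.reindex_bij_witness[of _ prod.swap prod.swap]) auto
  also have "\<dots> = (\<Sum>l\<le>m. \<Sum>k\<le>m - l. g k l)"
    by (simp add: sum.Sigma)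
  finally show ?thesis .
qed

text \<open>Both sides count the ordered pairs of disjoint subsets of sizes \<open>k\<close> and
  \<open>l\<close>.\<close>

lemma choose_mult_swap:
  assumes "k + l \<le> n"
  shows "(n choose k) * ((n - k) choose l) = (n choose l) * ((n - l) choose k)"
proof -
  have "(n choose (k + l)) * ((k + l) choose k) = (n choose k) * ((n - k) choose l)"
    using choose_mult[of k "k + l" n] assms by simp
  moreover have "(n choose (k + l)) * ((k + l) choose l) = (n choose l) * ((n - l) choose k)"
    using choose_mult[of l "k + l" n] assms by simp
  moreover have "(k + l) choose k = (k + l) choose l"
    using binomial_symmetric[of k "k + l"] by simp
  ultimately show ?thesis by simp
qed

text \<open>Faulhaber's formula. From \<open>n\<close> to \<open>n + 1\<close> the right-hand side
  grows by a polynomial in \<open>n\<close> all of whose coefficients, except that of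
  \<open>n ^ m\<close>, vanish by the Bernoulli recurrence. The power sum stops before
  \<open>n\<close>, which fits the convention B_1 = -1/2.\<close>

lemma sum_powers_bernoulli:
  "of_nat (Suc m) * (\<Sum>j<n. of_nat j ^ m) =
     (\<Sum>k\<le>m. of_nat (Suc m choose k) * bernoulli k * of_nat n ^ (Suc m - k))"
proof (induction n)
  case 0
  have "(\<Sum>k\<le>m. of_nat (Suc m choose k) * bernoulli k * 0 ^ (Suc m - k)) = 0"
    by (rule sum.neutral) (auto simp: Suc_diff_le)
  then show ?case by simp
next
  case (Suc n)
  define x :: rat where "x = of_nat n"
  let ?c = "\<lambda>k. of_nat (Suc m choose k) :: rat"
  \<comment> \<open>The binomial theorem with its top term split off; that term reproduces the
    formula for \<open>n\<close>.\<close>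
  have expand: "(1 + x) ^ (Suc m - k) = x ^ (Suc m - k)
      + (\<Sum>l\<le>m - k. of_nat ((Suc m - k) choose l) * x ^ l)" if "k \<le> m" for k
  proof -
    have "Suc m - k = Suc (m - k)" using that by simp
    then show ?thesis
      using binomial_ring[of x 1 "Suc m - k"] by (simp add: add.commute)
  qed
  \<comment> \<open>For \<open>l < m\<close> this is the recurrence; for \<open>l = m\<close> only
    \<open>bernoulli 0 = 1\<close> remains.\<close>
  have inner: "(\<Sum>k\<le>m - l. of_nat ((Suc m - l) choose k) * bernoulli k) = (if l = m then 1 else 0)"
    if "l \<le> m" for l
  proof (cases "l = m")
    case False
    then show ?thesis
      using bernoulli_recurrence[of "m - l"] that by (simp add: atLeast0AtMost Suc_diff_le)
  qed simp
  have "(\<Sum>k\<le>m. ?c k * bernoulli k * (1 + x) ^ (Suc m - k))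
      = (\<Sum>k\<le>m. ?c k * bernoulli k * x ^ (Suc m - k))
        + (\<Sum>k\<le>m. \<Sum>l\<le>m - k. ?c k * bernoulli k * (of_nat ((Suc m - k) choose l) * x ^ l))"
    unfolding sum.distrib[symmetric]
    by (rule sum.cong) (simp_all add: expand distrib_left sum_distrib_left del: power_Suc)
  also have "(\<Sum>k\<le>m. \<Sum>l\<le>m - k. ?c k * bernoulli k * (of_nat ((Suc m - k) choose l) * x ^ l))
      = (\<Sum>l\<le>m. \<Sum>k\<le>m - l. ?c k * bernoulli k * (of_nat ((Suc m - k) choose l) * x ^ l))"
    by (rule sum_triangle_swap)
  also have "\<dots> = (\<Sum>l\<le>m. ?c l * x ^ l * (\<Sum>k\<le>m - l. of_nat ((Suc m - l) choose k) * bernoulli k))"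
    unfolding sum_distrib_left
  proof (intro sum.cong refl)
    fix l k assume "l \<in> {..m}" "k \<in> {..m - l}"
    then have "?c k * of_nat ((Suc m - k) choose l) = ?c l * of_nat ((Suc m - l) choose k)"
      using choose_mult_swap[of k l "Suc m"] by (simp flip: of_nat_mult del: binomial_Suc_Suc)
    then show "?c k * bernoulli k * (of_nat ((Suc m - k) choose l) * x ^ l)
        = ?c l * x ^ l * (of_nat ((Suc m - l) choose k) * bernoulli k)"
      by (simp add: mult_ac del: binomial_Suc_Suc)
  qed
  also have "\<dots> = (\<Sum>l\<le>m. if l = m then ?c m * x ^ m else 0)"
    by (intro sum.cong refl) (simp add: inner)
  also have "\<dots> = of_nat (Suc m) * x ^ m"
    by simp
  finally show ?case
    using Suc.IH by (simp add: x_def distrib_left del: binomial_Suc_Suc power_Suc)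
qed

context prime_modulus
begin

text \<open>Up to index \<open>k\<close> the recursion divides only by numbers up to
  \<open>k + 1\<close>, all smaller than \<open>p\<close>.\<close>

lemma p_integral_bernoulli:
  "k + 1 < p \<Longrightarrow> bernoulli k \<in> p_integral p"
proof (induction k rule: less_induct)
  case (less k)
  show ?case
  proof (cases k)
    case (Suc n)
    have "\<not> p dvd Suc (Suc n)" using less.prems Suc by (auto dest: dvd_imp_le)
    then show ?thesis unfolding Suc bernoulli.simps(2)
      using less Suc
      by (intro p_integral_divide p_integral_uminus p_integral_sum p_integral_mult) auto
  qed auto
qed

text \<open>In Faulhaber's formula with \<open>n = p\<close> the terms \<open>k < s\<close> carry at
  least \<open>p ^ 2\<close>. The term \<open>k = s\<close> is \<open>Suc s\<close> times the
  claimed value, and \<open>Suc s\<close> is a unit modulo \<open>p\<close>.\<close>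

lemma sum_powers_cong:
  assumes "s + 1 < p"
  shows "rat_cong p 2 (\<Sum>i<p. of_nat i ^ s) (of_nat p * bernoulli s)"
proof -
  let ?f = "\<lambda>k. of_nat (Suc s choose k) * bernoulli k * of_nat p ^ (Suc s - k)"
  have "of_nat (Suc s) * (\<Sum>i<p. of_nat i ^ s) = (\<Sum>k\<le>s. ?f k)"
    by (rule sum_powers_bernoulli)
  also have "\<dots> = (\<Sum>k<s. ?f k) + of_nat (Suc s) * (of_nat p * bernoulli s)"
    by (simp add: lessThan_Suc_atMost[symmetric])
  also have "rat_cong p 2 \<dots> (0 + of_nat (Suc s) * (of_nat p * bernoulli s))"
  proof (rule rat_cong_add)
    have "rat_cong p 2 (?f k) 0" if "k < s" for k
    proof -
      have "bernoulli k \<in> p_integral p" using that assms by (intro p_integral_bernoulli) simp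
      then have integral: "of_nat (Suc s choose k) * bernoulli k * of_nat p ^ (s - k - 1) \<in> p_integral p"
        by (intro p_integral_mult p_integral_power p_integral_of_nat)
      have exponent: "Suc s - k = 2 + (s - k - 1)" using that by simp
      have "?f k = of_nat p ^ 2 * (of_nat (Suc s choose k) * bernoulli k * of_nat p ^ (s - k - 1))"
        unfolding exponent power_add by (simp add: mult_ac del: binomial_Suc_Suc)
      then show ?thesis using rat_cong_0I[OF integral, of 2] by (simp only:)
    qed
    then have "rat_cong p 2 (\<Sum>k<s. ?f k) (\<Sum>k<s. 0)"
      by (intro rat_cong_sum) (simp only: lessThan_iff)
    then show "rat_cong p 2 (\<Sum>k<s. ?f k) 0" by simp
  qed (rule rat_cong_refl)
  finally have "rat_cong p 2 (of_nat (Suc s) * (\<Sum>i<p. of_nat i ^ s))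
      (of_nat (Suc s) * (of_nat p * bernoulli s))"
    by (simp only: add_0_left)
  moreover have "\<not> p dvd Suc s" using assms by (auto dest: dvd_imp_le)
  ultimately show ?thesis by (rule rat_cong_cancel)
qed

lemma sum_powers_cong_0:
  assumes "0 < s" "s + 1 < p"
  shows "rat_cong p 1 (\<Sum>i\<in>{1..<p}. of_nat i ^ s) 0"
proof -
  have "rat_cong p 1 (\<Sum>i<p. of_nat i ^ s) (of_nat p * bernoulli s)"
    using sum_powers_cong[OF assms(2)] by (rule rat_cong_mono) simp
  also have "rat_cong p 1 (of_nat p * bernoulli s) 0"
    using rat_cong_0I[OF p_integral_bernoulli[OF assms(2)], of 1] by simp
  also have "(\<Sum>i<p. of_nat i ^ s) = (\<Sum>i\<in>{1..<p}. of_nat i ^ s :: rat)"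
    using assms by (intro sum.mono_neutral_right) auto
  finally show ?thesis .
qed


section \<open>Fermat inverses and a congruence of Voronoi\<close>

lemma fermat_cong:
  assumes "\<not> p dvd i"
  shows "rat_cong p 1 (of_nat i ^ (p - 1)) 1"
proof -
  have "[i ^ (p - 1) = 1] (mod p)" using fermat_theorem[OF prime_p assms] .
  then show ?thesis using rat_cong_of_nat[of "i ^ (p - 1)" 1 1] by simp
qed

text \<open>Fermat's theorem exchanges negative powers for nonnegative ones, to which Faulhaber's
  formula applies.\<close>

lemma power_cong_inverse:
  assumes "\<not> p dvd i" "k < p"
  shows "rat_cong p 1 (of_nat i ^ (p - 1 - k)) (1 / of_nat i ^ k)"
proof (rule rat_cong_cancel[of 1 "i ^ k"])
  show "\<not> p dvd i ^ k" using assms prime_p by (meson prime_dvd_power)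
  have "k + (p - 1 - k) = p - 1" using assms(2) by simp
  then have "of_nat (i ^ k) * of_nat i ^ (p - 1 - k) = (of_nat i ^ (p - 1) :: rat)"
    by (simp flip: power_add)
  moreover have "i \<noteq> 0" using assms(1) by (intro notI) simp
  ultimately show "rat_cong p 1 (of_nat (i ^ k) * of_nat i ^ (p - 1 - k))
      (of_nat (i ^ k) * (1 / of_nat i ^ k))"
    using fermat_cong[OF assms(1)] by simp
qed

lemma not_dvd_range: "i \<in> {1..<p} \<Longrightarrow> \<not> p dvd i"
  by (auto dest: dvd_imp_le)

lemma power_first_order:
  assumes "x \<in> p_integral p" "f \<in> p_integral p"
  shows "rat_cong p 2 ((x - of_nat p * f) ^ Suc m)
           (x ^ Suc m - of_nat (Suc m) * (of_nat p * f) * x ^ m)"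
proof (induction m)
  case (Suc m)
  let ?d = "of_nat p * f"
  have "rat_cong p 2 ((x - ?d) * (x - ?d) ^ Suc m)
      ((x - ?d) * (x ^ Suc m - of_nat (Suc m) * ?d * x ^ m))"
    using assms by (intro rat_cong_mult_left Suc) auto
  also have "(x - ?d) * (x ^ Suc m - of_nat (Suc m) * ?d * x ^ m)
      = x ^ Suc (Suc m) - of_nat (Suc (Suc m)) * ?d * x ^ Suc m
        + of_nat p ^ 2 * (of_nat (Suc m) * f ^ 2 * x ^ m)"
    by (simp add: algebra_simps power2_eq_square)
  also have "rat_cong p 2 \<dots> (x ^ Suc (Suc m) - of_nat (Suc (Suc m)) * ?d * x ^ Suc m + 0)"
    using assms by (intro rat_cong_add rat_cong_refl rat_cong_0I p_integral_mult p_integral_power) auto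
  finally show ?case by simp
qed simp

lemma bij_betw_mult_mod:
  assumes "\<not> p dvd q"
  shows "bij_betw (\<lambda>i. q * i mod p) {1..<p} {1..<p}"
proof -
  have cop: "coprime q p"
    using prime_imp_coprime[OF prime_p assms] by (simp add: coprime_commute)
  have "inj_on (\<lambda>i. q * i mod p) {1..<p}"
  proof
    fix i j assume ij: "i \<in> {1..<p}" "j \<in> {1..<p}" "q * i mod p = q * j mod p"
    then have "[q * i = q * j] (mod p)" by (simp add: cong_def)
    then have "[i = j] (mod p)" using cop by (simp add: cong_mult_lcancel_nat)
    then show "i = j" using ij by (simp add: cong_def)
  qed
  moreover have "(\<lambda>i. q * i mod p) ` {1..<p} \<subseteq> {1..<p}"
  proof safe
    fix i assume i: "i \<in> {1..<p}"
    then have "\<not> p dvd q * i" using assms prime_p not_dvd_range[OF i] prime_dvd_multD by blast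
    then show "q * i mod p \<in> {1..<p}"
      using prime_gt_0_nat[OF prime_p] by (simp add: mod_greater_zero_iff_not_dvd Suc_le_eq)
  qed
  ultimately show ?thesis
    by (simp add: bij_betw_def endo_inj_surj)
qed

text \<open>A congruence of Voronoi: sum the first-order expansion of \<open>(q i mod p) ^ (p - 3)\<close>
  modulo \<open>p\<^sup>2\<close> and use that \<open>i \<mapsto> q i mod p\<close> is a permutation.\<close>
lemma voronoi_cong:
  assumes "3 < p" "\<not> p dvd q"
  shows "rat_cong p 1 (3 * (\<Sum>i\<in>{1..<p}. of_nat (q * i div p) / of_nat i ^ 3))
           ((of_nat q ^ 3 - of_nat q) * bernoulli (p - 3))"
proof -
  \<comment> \<open>The Bernoulli index \<open>p - 3\<close> is \<open>Suc m\<close>; the linear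
    term of the expansion lowers the exponent to \<open>m\<close>.\<close>
  define m where "m = p - 4"
  have p_eq: "p = m + 4" using assms(1) by (simp add: m_def)
  define f where "f i = (of_nat (q * i div p) :: rat)" for i
  define B where "B = bernoulli (Suc m)"
  define S where "S = (\<Sum>i\<in>{1..<p}. of_nat i ^ Suc m :: rat)"
  define W where "W = (\<Sum>i\<in>{1..<p}. f i * of_nat i ^ m)"
  have B: "B \<in> p_integral p"
    unfolding B_def by (rule p_integral_bernoulli) (simp add: p_eq)
  have S: "rat_cong p 2 S (of_nat p * B)"
  proof -
    have "S = (\<Sum>i<p. of_nat i ^ Suc m)"
      unfolding S_def by (intro sum.mono_neutral_left) auto
    then show ?thesis
      using sum_powers_cong[of "Suc m"] by (simp add: p_eq B_def)
  qed
  have W_int: "W \<in> p_integral p"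
    unfolding W_def f_def by (intro p_integral_sum p_integral_mult p_integral_power) auto
  have "S = (\<Sum>i\<in>{1..<p}. of_nat (q * i mod p) ^ Suc m)"
    unfolding S_def using sum.reindex_bij_betw[OF bij_betw_mult_mod[OF assms(2)]]
    by (rule sym)
  also have "\<dots> = (\<Sum>i\<in>{1..<p}. (of_nat (q * i) - of_nat p * f i) ^ Suc m)"
  proof (intro sum.cong refl)
    fix i
    have "of_nat (q * i) = (of_nat (p * (q * i div p) + q * i mod p) :: rat)"
      by (simp only: mult_div_mod_eq)
    then have "of_nat (q * i mod p) = (of_nat (q * i) - of_nat p * f i :: rat)"
      by (simp only: f_def of_nat_add of_nat_mult)
    then show "of_nat (q * i mod p) ^ Suc m = (of_nat (q * i) - of_nat p * f i) ^ Suc m"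
      by simp
  qed
  also have "rat_cong p 2 \<dots> (\<Sum>i\<in>{1..<p}. of_nat (q * i) ^ Suc m
      - of_nat (Suc m) * (of_nat p * f i) * of_nat (q * i) ^ m)"
    by (intro rat_cong_sum power_first_order) (auto simp: f_def)
  also have "(\<Sum>i\<in>{1..<p}. of_nat (q * i) ^ Suc m
      - of_nat (Suc m) * (of_nat p * f i) * of_nat (q * i) ^ m)
      = of_nat q ^ Suc m * S - of_nat p * (of_nat (Suc m) * of_nat q ^ m * W)"
    unfolding S_def W_def sum_distrib_left sum_subtractf[symmetric]
    by (intro sum.cong refl) (simp add: power_mult_distrib algebra_simps)
  \<comment> \<open>\<open>S\<close> occurs on both sides. Solving for the linear term leaves
    \<open>p\<close> times a multiple of \<open>W\<close> against a multiple of \<open>S\<close>;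
    since \<open>S\<close> is \<open>p * B\<close> modulo \<open>p ^ 2\<close>, one factor
    \<open>p\<close> cancels.\<close>
  finally have "rat_cong p 2 (S - S + of_nat p * (of_nat (Suc m) * of_nat q ^ m * W))
      ((of_nat q ^ Suc m * S - of_nat p * (of_nat (Suc m) * of_nat q ^ m * W)) - S
        + of_nat p * (of_nat (Suc m) * of_nat q ^ m * W))"
    by (intro rat_cong_add rat_cong_diff rat_cong_refl)
  then have "rat_cong p 2 (of_nat p * (of_nat (Suc m) * of_nat q ^ m * W))
      ((of_nat q ^ Suc m - 1) * S)"
    by (simp add: algebra_simps)
  also have "rat_cong p 2 \<dots> ((of_nat q ^ Suc m - 1) * (of_nat p * B))"
    by (intro rat_cong_mult_left S) auto
  finally have "rat_cong p (1 + 1) (of_nat p ^ 1 * (of_nat (Suc m) * of_nat q ^ m * W))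
      (of_nat p ^ 1 * ((of_nat q ^ Suc m - 1) * B))"
    by (simp add: algebra_simps numeral_2_eq_2)
  then have "rat_cong p 1 (of_nat (Suc m) * of_nat q ^ m * W) ((of_nat q ^ Suc m - 1) * B)"
    by (rule rat_cong_unscale)
  \<comment> \<open>The factor \<open>q ^ 3\<close> completes \<open>q ^ m\<close> to
    \<open>q ^ (p - 1)\<close>, which Fermat's theorem removes.\<close>
  then have "rat_cong p 1 (of_nat q ^ 3 * (of_nat (Suc m) * of_nat q ^ m * W))
      (of_nat q ^ 3 * ((of_nat q ^ Suc m - 1) * B))"
    by (rule rat_cong_mult_left) auto
  then have main: "rat_cong p 1 (of_nat q ^ (p - 1) * (of_nat (Suc m) * W))
      ((of_nat q * of_nat q ^ (p - 1) - of_nat q ^ 3) * B)"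
    by (simp add: p_eq power_add algebra_simps eval_nat_numeral)
  \<comment> \<open>\<open>Suc m\<close> equals \<open>p - 3\<close>; this is the origin of the
    factor 3 in the congruence.\<close>
  have "rat_cong p 1 (- 3) (of_nat (Suc m))"
    by (rule rat_congI[OF p_integral_minus_1]) (simp add: p_eq)
  then have "rat_cong p 1 (1 * ((- 3) * W)) (1 * (of_nat (Suc m) * W))"
    using W_int by (intro rat_cong_mult_left rat_cong_mult_right p_integral_1)
  also have "rat_cong p 1 \<dots> (of_nat q ^ (p - 1) * (of_nat (Suc m) * W))"
    using rat_cong_sym[OF fermat_cong[OF assms(2)]] W_int
    by (intro rat_cong_mult_right p_integral_mult p_integral_of_nat)
  also note main
  also have "rat_cong p 1 ((of_nat q * of_nat q ^ (p - 1) - of_nat q ^ 3) * B)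
     ((of_nat q * 1 - of_nat q ^ 3) * B)"
    by (intro rat_cong_mult_right rat_cong_mult_left rat_cong_diff fermat_cong assms B) auto
  finally have "rat_cong p 1 (3 * W) ((of_nat q ^ 3 - of_nat q) * B)"
    using rat_cong_uminus[of 1 "1 * ((- 3) * W)" "(of_nat q * 1 - of_nat q ^ 3) * B"]
    by (simp add: algebra_simps)
  moreover have "rat_cong p 1 (3 * (\<Sum>i\<in>{1..<p}. f i / of_nat i ^ 3)) (3 * W)"
    unfolding W_def
  proof (intro rat_cong_mult_left rat_cong_sum p_integral_numeral)
    fix i assume i: "i \<in> {1..<p}"
    have exponent: "p - 1 - 3 = m" by (simp add: p_eq)
    have "rat_cong p 1 (f i * (1 / of_nat i ^ 3)) (f i * of_nat i ^ m)"
      using rat_cong_sym[OF power_cong_inverse[OF not_dvd_range[OF i] assms(1), unfolded exponent]]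
      by (rule rat_cong_mult_left) (simp add: f_def)
    then show "rat_cong p 1 (f i / of_nat i ^ 3) (f i * of_nat i ^ m)" by simp
  qed
  moreover have "p - 3 = Suc m" by (simp add: p_eq)
  ultimately show ?thesis
    unfolding f_def[symmetric] B_def by (metis rat_cong_trans)
qed


section \<open>Power sums weighted by inverse squares\<close>

lemma choose_two_cong:
  assumes "2 < p"
  shows "rat_cong p 1 (of_nat ((p - 1) choose 2)) 1"
proof (rule rat_cong_cancel[of 1 2])
  obtain m where p_eq: "p = m + 3"
    using le_Suc_ex[of 3 p] assms by (auto simp: add.commute)
  have "(Suc (Suc m) choose 2) * 2 = Suc (Suc m) * Suc m"
    unfolding choose_two by simp
  then have "of_nat 2 * of_nat ((p - 1) choose 2) = ((of_nat m + 2) * (of_nat m + 1) :: rat)"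
    unfolding p_eq by (simp flip: of_nat_mult of_nat_add add: numeral_eq_Suc algebra_simps del: of_nat_Suc)
  also have "\<dots> = of_nat 2 * 1 + of_nat p ^ 1 * of_nat m"
    by (simp add: p_eq algebra_simps)
  finally show "rat_cong p 1 (of_nat 2 * of_nat ((p - 1) choose 2)) (of_nat 2 * 1)"
    by (intro rat_congI[of "of_nat m"]) auto
  show "\<not> p dvd 2" using assms by (auto dest: dvd_imp_le)
qed

text \<open>Faulhaber's formula, multiplied by \<open>p - 1\<close>, turns the inner sum into powers
  of \<open>q * i\<close>. After division by \<open>i ^ 2\<close> and summation over
  \<open>i\<close>, only the power \<open>i ^ 0\<close> survives modulo \<open>p\<close>; it belongs
  to \<open>k = p - 3\<close>.\<close>

lemma weighted_power_sum_cong: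
  assumes "3 < p"
  shows "rat_cong p 1 (\<Sum>i\<in>{1..<p}. (\<Sum>j<q * i. of_nat j ^ (p - 2)) / of_nat i ^ 2)
           (of_nat q ^ 2 * bernoulli (p - 3))"
proof (rule rat_cong_cancel[of 1 "p - 1"])
  show "\<not> p dvd p - 1" using assms by (auto dest: dvd_imp_le)
  define S where "S s k = (\<Sum>i\<in>{1..<p}. of_nat i ^ k / of_nat i ^ s :: rat)" for s k
  define c where "c k = of_nat ((p - 1) choose k) * bernoulli k * of_nat q ^ (p - 1 - k)" for k
  have c: "c k \<in> p_integral p" if "k \<le> p - 2" for k
    using that assms unfolding c_def
    by (intro p_integral_mult p_integral_power p_integral_of_nat p_integral_bernoulli) simp
  have Suc_eq: "Suc (p - 2) = p - 1" using assms by simp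
  have "of_nat (p - 1) * (\<Sum>i\<in>{1..<p}. (\<Sum>j<q * i. of_nat j ^ (p - 2)) / of_nat i ^ 2)
      = (\<Sum>i\<in>{1..<p}. (of_nat (Suc (p - 2)) * (\<Sum>j<q * i. of_nat j ^ (p - 2))) / of_nat i ^ 2 :: rat)"
    unfolding Suc_eq by (simp add: sum_distrib_left)
  also have "\<dots> = (\<Sum>i\<in>{1..<p}. \<Sum>k\<le>p - 2. c k * (of_nat i ^ (p - 1 - k) / of_nat i ^ 2))"
  proof (intro sum.cong refl)
    fix i
    have "of_nat (Suc (p - 2)) * (\<Sum>j<q * i. of_nat j ^ (p - 2))
        = (\<Sum>k\<le>p - 2. c k * of_nat i ^ (p - 1 - k))"
      using sum_powers_bernoulli[of "p - 2" "q * i"]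
      unfolding Suc_eq c_def by (simp add: power_mult_distrib mult.assoc)
    then show "of_nat (Suc (p - 2)) * (\<Sum>j<q * i. of_nat j ^ (p - 2)) / of_nat i ^ 2
        = (\<Sum>k\<le>p - 2. c k * (of_nat i ^ (p - 1 - k) / of_nat i ^ 2))"
      by (simp only: sum_divide_distrib times_divide_eq_right)
  qed
  also have "\<dots> = (\<Sum>k\<le>p - 2. c k * S 2 (p - 1 - k))"
    unfolding S_def sum_distrib_left by (rule sum.swap)
  also have "rat_cong p 1 \<dots> (\<Sum>k\<le>p - 2. if k = p - 3 then c k * of_nat (p - 1) else 0)"
  proof (rule rat_cong_sum)
    fix k assume "k \<in> {..p - 2}"
    \<comment> \<open>The resulting exponent of \<open>i\<close> is zero, positive, or -1. The sums
      vanish modulo \<open>p\<close> in the last two cases, the third after replacing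
      \<open>1 / i\<close> by \<open>i ^ (p - 2)\<close>.\<close>
    then consider "k = p - 3" | "k < p - 3" | "k = p - 2" by fastforce
    then show "rat_cong p 1 (c k * S 2 (p - 1 - k)) (if k = p - 3 then c k * of_nat (p - 1) else 0)"
    proof cases
      case 1
      then have "p - 1 - k = 2" using assms by simp
      then have "S 2 (p - 1 - k) = of_nat (p - 1)" by (simp add: S_def)
      then show ?thesis using 1 by simp
    next
      case 2
      have "S 2 (p - 1 - k) = (\<Sum>i\<in>{1..<p}. of_nat i ^ (p - 3 - k))"
        unfolding S_def
      proof (intro sum.cong refl)
        fix i assume "i \<in> {1..<p}"
        then have "i \<noteq> 0" by simp
        moreover have exponent: "p - 1 - k = (p - 3 - k) + 2" using 2 by simp
        ultimately show "of_nat i ^ (p - 1 - k) / of_nat i ^ 2 = (of_nat i ^ (p - 3 - k) :: rat)"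
          unfolding exponent power_add by simp
      qed
      then have "rat_cong p 1 (S 2 (p - 1 - k)) 0"
        using sum_powers_cong_0[of "p - 3 - k"] 2 by simp
      from rat_cong_mult_left[OF this c] show ?thesis using 2 by simp
    next
      case 3
      then have exponent: "p - 1 - k = 1" "p - 1 - 1 = p - 2" using assms by simp_all
      have "rat_cong p 1 (S 2 1) (\<Sum>i\<in>{1..<p}. of_nat i ^ (p - 2))"
        unfolding S_def
      proof (rule rat_cong_sum)
        fix i assume i: "i \<in> {1..<p}"
        have "of_nat i ^ 1 / of_nat i ^ 2 = (1 / of_nat i ^ 1 :: rat)"
          using i by (simp add: power2_eq_square)
        then show "rat_cong p 1 (of_nat i ^ 1 / of_nat i ^ 2) (of_nat i ^ (p - 2))"
          using rat_cong_sym[OF power_cong_inverse[OF not_dvd_range[OF i], of 1]] assms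
          unfolding exponent by simp
      qed
      also have "rat_cong p 1 \<dots> 0" using assms by (intro sum_powers_cong_0) auto
      finally have "rat_cong p 1 (S 2 (p - 1 - k)) 0" unfolding exponent .
      from rat_cong_mult_left[OF this c] show ?thesis using 3 assms by simp
    qed
  qed
  also have "\<dots> = c (p - 3) * of_nat (p - 1)" by simp
  also have "c (p - 3) = of_nat ((p - 1) choose 2) * (of_nat q ^ 2 * bernoulli (p - 3))"
  proof -
    have "(p - 1) choose (p - 3) = (p - 1) choose 2"
      using binomial_symmetric[of "p - 3" "p - 1"] assms by simp
    moreover have "p - 1 - (p - 3) = 2" using assms by simp
    ultimately show ?thesis by (simp add: c_def)
  qed
  also have "rat_cong p 1 (of_nat ((p - 1) choose 2) * (of_nat q ^ 2 * bernoulli (p - 3)) * of_nat (p - 1))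
      (1 * (of_nat q ^ 2 * bernoulli (p - 3)) * of_nat (p - 1))"
    using assms
    by (intro rat_cong_mult_right choose_two_cong p_integral_mult p_integral_power
        p_integral_of_nat p_integral_bernoulli) auto
  finally show "rat_cong p 1
      (of_nat (p - 1) * (\<Sum>i\<in>{1..<p}. (\<Sum>j<q * i. of_nat j ^ (p - 2)) / of_nat i ^ 2))
      (of_nat (p - 1) * (of_nat q ^ 2 * bernoulli (p - 3)))"
    by (simp add: mult.commute)
qed

section \<open>Sums over pairs with a given total\<close>

text \<open>The possible second entries of a triple whose last two entries add up to
  \<open>L\<close>. The bound \<open>j < L\<close> makes \<open>L - j\<close> a genuine positive
  difference.\<close>

definition summands :: "nat \<Rightarrow> nat set" where
  "summands L = {j. 0 < j \<and> j < L \<and> \<not> p dvd j \<and> \<not> p dvd L - j}"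

lemma finite_summands [simp]: "finite (summands L)"
  by (rule finite_subset[of _ "{..<L}"]) (auto simp: summands_def)

text \<open>The numbers \<open>L - j\<close> run through \<open>1..L\<close>, so the multiples of
  \<open>p\<close> in that range are counted.\<close>

lemma card_dvd_diff: "card {j\<in>{..<L}. p dvd L - j} = L div p"
proof -
  have p_pos: "p > 0" using prime_p prime_gt_0_nat by blast
  have "bij_betw (\<lambda>t. L - p * t) {1..L div p} {j\<in>{..<L}. p dvd L - j}"
  proof (rule bij_betw_byWitness[of _ "\<lambda>j. (L - j) div p"])
    have le: "p * t \<le> L" if "t \<le> L div p" for t
      using that p_pos by (metis div_times_less_eq_dividend less_eq_div_iff_mult_less_eq mult.commute)
    show "\<forall>t\<in>{1..L div p}. (L - (L - p * t)) div p = t"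
      using le p_pos by auto
    show "(\<lambda>t. L - p * t) ` {1..L div p} \<subseteq> {j\<in>{..<L}. p dvd L - j}"
    proof (rule image_subsetI)
      fix t assume t: "t \<in> {1..L div p}"
      then have "p * t \<le> L" "0 < p * t" using le p_pos by auto
      then have "L - p * t < L" by (meson diff_less less_le_trans)
      then show "L - p * t \<in> {j\<in>{..<L}. p dvd L - j}" using \<open>p * t \<le> L\<close> by simp
    qed
    show "\<forall>j\<in>{j\<in>{..<L}. p dvd L - j}. L - p * ((L - j) div p) = j"
      by auto
    show "(\<lambda>j. (L - j) div p) ` {j\<in>{..<L}. p dvd L - j} \<subseteq> {1..L div p}"
      using p_pos by (auto simp: div_le_mono Suc_le_eq div_greater_zero_iff dvd_imp_le)
  qed
  then show ?thesis using bij_betw_same_card by fastforce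
qed

text \<open>Modulo \<open>p\<close>, \<open>j ^ (p - 2)\<close> is \<open>1 / j\<close>, or zero if
  \<open>p\<close> divides \<open>j\<close>. So the full power sum exceeds the wanted sum only by
  the \<open>j\<close> congruent to \<open>L\<close>; there are \<open>L div p\<close> of them, each
  contributing \<open>1 / L\<close>.\<close>

lemma sum_inverse_summands:
  assumes "2 < p" "\<not> p dvd L"
  shows "rat_cong p 1 (\<Sum>j\<in>summands L. 1 / of_nat j)
           ((\<Sum>j<L. of_nat j ^ (p - 2)) - of_nat (L div p) / of_nat L)"
proof -
  have exponent: "p - 1 - 1 = p - 2" "p - 2 = Suc (p - 3)" using assms by simp_all
  let ?f = "\<lambda>j. if p dvd L - j then 1 / of_nat L else 0 :: rat"
  let ?g = "\<lambda>j. if j \<in> summands L then 1 / of_nat j else 0 :: rat"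
  have inv: "rat_cong p 1 (of_nat j ^ (p - 2)) (1 / of_nat j)" if "\<not> p dvd j" for j
    using power_cong_inverse[OF that, of 1] assms(1) unfolding exponent(1) by simp
  have "rat_cong p 1 (\<Sum>j<L. of_nat j ^ (p - 2)) (\<Sum>j<L. ?f j + ?g j)"
  proof (rule rat_cong_sum)
    fix j assume j: "j \<in> {..<L}"
    \<comment> \<open>The second case contains \<open>j = 0\<close>, because \<open>p\<close> does
      not divide \<open>L\<close>.\<close>
    consider "p dvd L - j" | "\<not> p dvd L - j" "p dvd j" | "j \<in> summands L"
      using j by (auto simp: summands_def intro!: Nat.gr0I)
    then show "rat_cong p 1 (of_nat j ^ (p - 2)) (?f j + ?g j)"
    proof cases
      case 1
      have not_dvd: "\<not> p dvd j"
      proof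
        assume "p dvd j"
        with 1 have "p dvd (L - j) + j" by (rule dvd_add)
        with j assms(2) show False by simp
      qed
      have "[j = L] (mod p)"
        using 1 j by (metis cong_altdef_nat lessThan_iff less_imp_le cong_sym)
      then have "rat_cong p 1 (1 / of_nat j) (1 / of_nat L)"
        by (intro rat_cong_inverse rat_cong_of_nat not_dvd assms) simp
      then have "rat_cong p 1 (of_nat j ^ (p - 2)) (1 / of_nat L)"
        by (rule rat_cong_trans[OF inv[OF not_dvd]])
      then show ?thesis using 1 by (simp add: summands_def)
    next
      case 2
      then obtain t where "j = p * t" by blast
      then have "of_nat j ^ (p - 2) = (of_nat p ^ 1 * (of_nat t * of_nat j ^ (p - 3)) :: rat)"
        unfolding exponent(2) by simp
      then show ?thesis using 2 rat_cong_0I[of "of_nat t * of_nat j ^ (p - 3)" 1]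
        by (simp add: summands_def p_integral_mult p_integral_power)
    next
      case 3
      then show ?thesis using inv[of j] by (simp add: summands_def)
    qed
  qed
  also have "(\<Sum>j<L. ?f j + ?g j) = of_nat (L div p) / of_nat L + (\<Sum>j\<in>summands L. 1 / of_nat j)"
  proof -
    have "(\<Sum>j<L. ?f j) = of_nat (L div p) / of_nat L"
      using card_dvd_diff[of L] by (simp add: sum.inter_filter[symmetric])
    moreover have "(\<Sum>j<L. ?g j) = (\<Sum>j\<in>summands L. 1 / of_nat j)"
      by (intro sum.mono_neutral_cong_right) (auto simp: summands_def)
    ultimately show ?thesis by (simp add: sum.distrib)
  qed
  finally have "rat_cong p 1
      ((\<Sum>j<L. of_nat j ^ (p - 2)) - of_nat (L div p) / of_nat L)
      (of_nat (L div p) / of_nat L + (\<Sum>j\<in>summands L. 1 / of_nat j) - of_nat (L div p) / of_nat L)"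
    by (intro rat_cong_diff rat_cong_refl)
  then show ?thesis by (simp add: rat_cong_sym)
qed

text \<open>Partial fractions, together with the reflection from \<open>j\<close> to
  \<open>L - j\<close>.\<close>

lemma sum_inverse_pairs:
  "(\<Sum>j\<in>summands L. 1 / (of_nat j * of_nat (L - j))) =
     2 / of_nat L * (\<Sum>j\<in>summands L. 1 / of_nat j :: rat)"
proof -
  have "(\<Sum>j\<in>summands L. 1 / (of_nat j * of_nat (L - j)))
      = (\<Sum>j\<in>summands L. 1 / of_nat L * (1 / of_nat j + 1 / of_nat (L - j)) :: rat)"
    by (intro sum.cong refl) (auto simp: summands_def field_simps of_nat_diff)
  also have "\<dots> = 1 / of_nat L * ((\<Sum>j\<in>summands L. 1 / of_nat j) + (\<Sum>j\<in>summands L. 1 / of_nat (L - j)))"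
    by (simp only: sum_distrib_left[symmetric] sum.distrib)
  also have "(\<Sum>j\<in>summands L. 1 / of_nat (L - j)) = (\<Sum>j\<in>summands L. 1 / of_nat j :: rat)"
    by (rule sum.reindex_bij_witness[of _ "\<lambda>j. L - j" "\<lambda>j. L - j"]) (auto simp: summands_def)
  finally show ?thesis by simp
qed

text \<open>Modulo \<open>p\<close> the factor \<open>q * (p - i)\<close> is
  \<open>- (q * i)\<close>. The sum over pairs is \<open>2 / (q * i)\<close> times a sum of
  inverses, which splits into the Voronoi sum \<open>V\<close> and the weighted power sum
  \<open>X\<close>. The factor 3 is inherited from Voronoi's congruence.\<close>

lemma triple_sum_cong:
  assumes "3 < p" "\<not> p dvd q"
  shows "rat_cong p 1
           (3 * (\<Sum>i\<in>{1..<p}. \<Sum>j\<in>summands (q * i).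
              1 / (of_nat (q * (p - i)) * of_nat j * of_nat (q * i - j))))
           (- 2 * bernoulli (p - 3) * (2 + 1 / of_nat q ^ 2))"
proof -
  define B where "B = bernoulli (p - 3)"
  have B: "B \<in> p_integral p" unfolding B_def using assms by (intro p_integral_bernoulli) simp
  have q_nz: "q \<noteq> 0" using assms(2) by (intro notI) simp
  have q_inv: "x / of_nat q ^ k \<in> p_integral p" if "x \<in> p_integral p" for x k
  proof -
    have "\<not> p dvd q ^ k" using prime_dvd_power[OF prime_p] assms(2) by blast
    from p_integral_divide[OF that this] show ?thesis by simp
  qed
  define S where "S L = (\<Sum>j<L. of_nat j ^ (p - 2) :: rat)" for L
  define V where "V = (\<Sum>i\<in>{1..<p}. of_nat (q * i div p) / of_nat i ^ 3 :: rat)"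
  define X where "X = (\<Sum>i\<in>{1..<p}. S (q * i) / of_nat i ^ 2 :: rat)"
  have term_cong: "rat_cong p 1 (\<Sum>j\<in>summands (q * i). 1 / (of_nat (q * (p - i)) * of_nat j * of_nat (q * i - j)))
      (2 / of_nat q ^ 3 * (of_nat (q * i div p) / of_nat i ^ 3)
        - 2 / of_nat q ^ 2 * (S (q * i) / of_nat i ^ 2))" (is "rat_cong p 1 ?lhs _")
    if i: "i \<in> {1..<p}" for i
  proof -
    let ?K = "\<Sum>j\<in>summands (q * i). 1 / of_nat j :: rat"
    have i_nz: "i \<noteq> 0" using i by simp
    have ni: "\<not> p dvd i" using i by (rule not_dvd_range)
    then have nqi: "\<not> p dvd q * i" using assms(2) prime_p by (meson prime_dvd_mult_iff)
    have "\<not> p dvd p - i" using i by (intro not_dvd_range) auto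
    then have nqpi: "\<not> p dvd q * (p - i)" using assms(2) prime_p by (meson prime_dvd_mult_iff)
    have K: "?K \<in> p_integral p"
      by (intro p_integral_sum p_integral_inverse) (auto simp: summands_def)
    \<comment> \<open>The difference is
      \<open>1 / (q * (p - i)) + 1 / (q * i) = p / (q * (p - i) * i)\<close>.\<close>
    have inv_cong: "rat_cong p 1 (1 / of_nat (q * (p - i))) (- (1 / of_nat (q * i)))"
    proof (rule rat_congI)
      show "1 / of_nat (q * (p - i)) * (1 / of_nat i) \<in> p_integral p"
        by (intro p_integral_mult p_integral_inverse nqpi ni)
      have eq: "(of_nat (q * (p - i)) :: rat) = of_nat q * (of_nat p - of_nat i)"
        using i by (simp add: of_nat_diff)
      have "(of_nat p - of_nat i :: rat) \<noteq> 0" using i by simp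
      then show "1 / of_nat (q * (p - i)) - - (1 / of_nat (q * i))
          = (of_nat p ^ 1 * (1 / of_nat (q * (p - i)) * (1 / of_nat i)) :: rat)"
        unfolding eq using q_nz i_nz by (simp add: field_simps)
    qed
    have "?lhs = 1 / of_nat (q * (p - i)) * (\<Sum>j\<in>summands (q * i). 1 / (of_nat j * of_nat (q * i - j)))"
      unfolding sum_distrib_left by (simp add: mult.assoc)
    also have "\<dots> = 1 / of_nat (q * (p - i)) * (2 * (1 / of_nat (q * i)) * ?K)"
      unfolding sum_inverse_pairs by simp
    also have "rat_cong p 1 \<dots> (- (1 / of_nat (q * i)) * (2 * (1 / of_nat (q * i)) * ?K))"
      by (intro rat_cong_mult_right inv_cong p_integral_mult p_integral_numeral p_integral_inverse nqi K)
    also have "\<dots> = - 2 * (1 / of_nat (q * i)) * (1 / of_nat (q * i)) * ?K" by simp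
    also have "rat_cong p 1 \<dots> (- 2 * (1 / of_nat (q * i)) * (1 / of_nat (q * i))
        * (S (q * i) - of_nat (q * i div p) / of_nat (q * i)))"
      unfolding S_def using assms(1)
      by (intro rat_cong_mult_left sum_inverse_summands nqi p_integral_mult p_integral_inverse
          p_integral_neg_numeral) simp
    also have "\<dots> = 2 / of_nat q ^ 3 * (of_nat (q * i div p) / of_nat i ^ 3)
        - 2 / of_nat q ^ 2 * (S (q * i) / of_nat i ^ 2)"
      using q_nz i_nz by (simp add: field_simps eval_nat_numeral)
    finally show ?thesis .
  qed
  have "rat_cong p 1
           (3 * (\<Sum>i\<in>{1..<p}. \<Sum>j\<in>summands (q * i).
              1 / (of_nat (q * (p - i)) * of_nat j * of_nat (q * i - j))))
     (3 * (\<Sum>i\<in>{1..<p}. 2 / of_nat q ^ 3 * (of_nat (q * i div p) / of_nat i ^ 3)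
        - 2 / of_nat q ^ 2 * (S (q * i) / of_nat i ^ 2)))"
    by (intro rat_cong_mult_left rat_cong_sum term_cong p_integral_numeral)
  also have "\<dots> = 2 / of_nat q ^ 3 * (3 * V) - 6 / of_nat q ^ 2 * X"
    by (simp add: V_def X_def sum_subtractf sum_distrib_left algebra_simps)
  also have "rat_cong p 1 \<dots> (2 / of_nat q ^ 3 * ((of_nat q ^ 3 - of_nat q) * B)
      - 6 / of_nat q ^ 2 * (of_nat q ^ 2 * B))"
    unfolding V_def X_def S_def B_def
    by (intro rat_cong_diff rat_cong_mult_left voronoi_cong weighted_power_sum_cong assms
        q_inv p_integral_numeral)
  \<comment> \<open>This is \<open>2 * (1 - 1 / q ^ 2) - 6 = - 2 * (2 + 1 / q ^ 2)\<close>.\<close>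
  also have "\<dots> = - 2 * B * (2 + 1 / of_nat q ^ 2)"
    using q_nz by (simp add: field_simps eval_nat_numeral)
  finally show ?thesis unfolding B_def .
qed

end

subsection \<open>Sums over triples\<close>

text \<open>Total and modulus are separate parameters: the total gets multiplied while the
  coprimality condition stays fixed. \<open>Z n\<close> is \<open>triple_sum n n\<close>.\<close>

definition triple_sum :: "nat \<Rightarrow> nat \<Rightarrow> rat" where
  "triple_sum N d = (\<Sum>(i, j, k)\<in>coprime_triples N d. 1 / (of_nat i * of_nat j * of_nat k))"

text \<open>If the residues modulo \<open>n\<close> of a triple with total \<open>m * n\<close> add
  up to \<open>s * n\<close>, its quotients form such a triple. Adding \<open>s\<close> on the left,
  instead of subtracting it from \<open>m\<close>, leaves the set empty for
  \<open>m < s\<close>.\<close>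

definition weak_triples :: "nat \<Rightarrow> nat \<Rightarrow> (nat \<times> nat \<times> nat) set" where
  "weak_triples s m = {(x, y, z). x + y + z + s = m}"

lemma finite_weak_triples [simp]: "finite (weak_triples s m)"
  by (rule finite_subset[of _ "{..m} \<times> {..m} \<times> {..m}"]) (auto simp: weak_triples_def)

text \<open>Truncated subtraction gives the correct value 0 once \<open>s\<close> exceeds
  \<open>m + 1\<close>.\<close>

lemma card_weak_pairs: "card {(y, z). y + z + s = Suc m} = m + 2 - s"
proof -
  have "bij_betw (\<lambda>y. (y, Suc m - s - y)) {..<m + 2 - s} {(y, z). y + z + s = Suc m}"
    by (rule bij_betw_byWitness[of _ fst]) auto
  then show ?thesis using bij_betw_same_card by fastforce
qed

text \<open>Triples with positive first entry shift down to \<open>m\<close>; first entry 0 leaves a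
  pair. A constant \<open>h\<close> yields a recursion for the count, \<open>h = of_nat\<close> one
  for the first moment.\<close>

lemma sum_weak_triples_Suc:
  fixes h :: "nat \<Rightarrow> rat"
  shows "(\<Sum>(x, y, z)\<in>weak_triples s (Suc m). h x) =
     (\<Sum>(x, y, z)\<in>weak_triples s m. h (Suc x)) + of_nat (m + 2 - s) * h 0"
proof -
  let ?A = "weak_triples s (Suc m)" and ?P = "{(y, z). y + z + s = Suc m}"
  have split: "?A = {t\<in>?A. fst t \<noteq> 0} \<union> {t\<in>?A. fst t = 0}" by auto
  have "(\<Sum>(x, y, z)\<in>?A. h x) = (\<Sum>(x, y, z)\<in>{t\<in>?A. fst t \<noteq> 0}. h x)
      + (\<Sum>(x, y, z)\<in>{t\<in>?A. fst t = 0}. h x)"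
    by (subst split, rule sum.union_disjoint) (auto intro: finite_subset[OF _ finite_weak_triples])
  also have "(\<Sum>(x, y, z)\<in>{t\<in>?A. fst t \<noteq> 0}. h x) = (\<Sum>(x, y, z)\<in>weak_triples s m. h (Suc x))"
    by (rule sum.reindex_bij_witness[of _ "\<lambda>(x, y, z). (Suc x, y, z)" "\<lambda>(x, y, z). (x - 1, y, z)"])
      (auto simp: weak_triples_def)
  also have "(\<Sum>(x, y, z)\<in>{t\<in>?A. fst t = 0}. h x) = (\<Sum>(y, z)\<in>?P. h 0)"
    by (rule sum.reindex_bij_witness[of _ "\<lambda>(y, z). (0, y, z)" "\<lambda>(x, y, z). (y, z)"])
      (auto simp: weak_triples_def)
  also have "\<dots> = of_nat (m + 2 - s) * h 0"
    by (simp add: split_def card_weak_pairs[unfolded split_def])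
  finally show ?thesis .
qed

lemma weak_triples_0: "s > 0 \<Longrightarrow> weak_triples s 0 = {}"
  by (auto simp: weak_triples_def)

lemma card_weak_triples_Suc:
  "(of_nat (card (weak_triples s (Suc m))) :: rat) =
     of_nat (card (weak_triples s m)) + of_nat (m + 2 - s)"
  using sum_weak_triples_Suc[of "\<lambda>_. 1" s m] by (simp add: split_def)

lemma first_sum_weak_triples_Suc:
  "(\<Sum>(x, y, z)\<in>weak_triples s (Suc m). of_nat x :: rat) =
     (\<Sum>(x, y, z)\<in>weak_triples s m. of_nat x) + of_nat (card (weak_triples s m))"
  using sum_weak_triples_Suc[of of_nat s m] by (simp add: split_def sum.distrib add.commute)

text \<open>The counts are \<open>m + 1 choose 2\<close> and \<open>m choose 2\<close>, the first
  moments below \<open>m + 1 choose 3\<close> and \<open>m choose 3\<close>. Clearing denominators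
  over the rationals gives polynomial identities free of truncated subtraction.\<close>

lemma card_weak_triples_1: "2 * of_nat (card (weak_triples 1 m)) = (of_nat m * (of_nat m + 1) :: rat)"
  by (induction m) (simp_all add: weak_triples_0 card_weak_triples_Suc algebra_simps)

lemma card_weak_triples_2: "2 * of_nat (card (weak_triples 2 m)) = (of_nat m * (of_nat m - 1) :: rat)"
  by (induction m) (simp_all add: weak_triples_0 card_weak_triples_Suc algebra_simps)

lemma first_sum_weak_triples_1:
  "6 * (\<Sum>(x, y, z)\<in>weak_triples 1 m. of_nat x) = ((of_nat m - 1) * of_nat m * (of_nat m + 1) :: rat)"
proof (induction m)
  case (Suc m)
  show ?case
    unfolding first_sum_weak_triples_Suc distrib_left Suc
    using card_weak_triples_1[of m] by (simp add: algebra_simps)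
qed (simp add: weak_triples_0)

lemma first_sum_weak_triples_2:
  "6 * (\<Sum>(x, y, z)\<in>weak_triples 2 m. of_nat x) = ((of_nat m - 2) * (of_nat m - 1) * of_nat m :: rat)"
proof (induction m)
  case (Suc m)
  show ?case
    unfolding first_sum_weak_triples_Suc distrib_left Suc
    using card_weak_triples_2[of m] by (simp add: algebra_simps)
qed (simp add: weak_triples_0)

lemma sum_weak_triples_sym:
  fixes h :: "nat \<Rightarrow> 'a::comm_monoid_add"
  shows "(\<Sum>(x, y, z)\<in>weak_triples s m. h y) = (\<Sum>(x, y, z)\<in>weak_triples s m. h x)"
    and "(\<Sum>(x, y, z)\<in>weak_triples s m. h z) = (\<Sum>(x, y, z)\<in>weak_triples s m. h x)"
  by (rule sum.reindex_bij_witness[of _ "\<lambda>(x, y, z). (y, x, z)" "\<lambda>(x, y, z). (y, x, z)"];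
      auto simp: weak_triples_def)
    (rule sum.reindex_bij_witness[of _ "\<lambda>(x, y, z). (z, y, x)" "\<lambda>(x, y, z). (z, y, x)"];
      auto simp: weak_triples_def)

text \<open>By symmetry the sums of \<open>x\<close>, \<open>y\<close> and \<open>z\<close>
  agree.\<close>

lemma sum_linear_weak_triples:
  fixes r s t :: rat
  shows "(\<Sum>(x, y, z)\<in>weak_triples e m. of_nat x * r + of_nat y * s + of_nat z * t) =
     (\<Sum>(x, y, z)\<in>weak_triples e m. of_nat x) * (r + s + t)"
proof -
  have "(\<Sum>(x, y, z)\<in>weak_triples e m. of_nat x * r + of_nat y * s + of_nat z * t)
      = (\<Sum>(x, y, z)\<in>weak_triples e m. of_nat x) * r + (\<Sum>(x, y, z)\<in>weak_triples e m. of_nat y) * s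
        + (\<Sum>(x, y, z)\<in>weak_triples e m. of_nat z) * t"
    by (simp add: split_def sum.distrib sum_distrib_right)
  then show ?thesis
    unfolding sum_weak_triples_sym by (simp add: distrib_left)
qed

text \<open>The residues modulo \<open>n\<close> of \<open>i + j + k = m n\<close> sum to \<open>n\<close> or \<open>2 n\<close>; in the
  second case they are reflected by \<open>a \<mapsto> n - a\<close>.\<close>
lemma sum_coprime_triples_mult:
  fixes f :: "nat \<Rightarrow> nat \<Rightarrow> nat \<Rightarrow> 'a::comm_monoid_add"
  assumes "d dvd n" "d \<noteq> 1" "n > 0"
  shows "(\<Sum>(i, j, k)\<in>coprime_triples (m * n) d. f i j k) =
    (\<Sum>(a, b, c)\<in>coprime_triples n d.
       (\<Sum>(x, y, z)\<in>weak_triples 1 m. f (a + n * x) (b + n * y) (c + n * z))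
     + (\<Sum>(x, y, z)\<in>weak_triples 2 m. f (n - a + n * x) (n - b + n * y) (n - c + n * z)))"
proof -
  \<comment> \<open>A residue 0 would make the nontrivial divisor \<open>d\<close> of
    \<open>n\<close> divide \<open>i\<close>.\<close>
  have mod_pos: "0 < i mod n" if "coprime i d" for i
  proof -
    have "\<not> n dvd i"
      using coprime_common_divisor[OF that, of d] dvd_trans[OF assms(1), of i] assms(2) by auto
    then show ?thesis by (simp add: mod_greater_zero_iff_not_dvd)
  qed
  have coprime_mod: "coprime (i mod n) d \<longleftrightarrow> coprime i d" for i
  proof -
    have "[i mod n = i] (mod d)"
      using assms(1) by (simp add: cong_def mod_mod_cancel)
    then show ?thesis by (metis cong_imp_coprime cong_sym)
  qed
  have coprime_refl: "coprime (n - i) d \<longleftrightarrow> coprime i d" if "i \<le> n" for i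
  proof -
    have "c dvd n - i \<longleftrightarrow> c dvd i" if "c dvd d" for c
      using dvd_trans[OF that assms(1)] \<open>i \<le> n\<close> by (auto dest: dvd_diffD1 intro: dvd_diff_nat)
    then show ?thesis by (auto simp: coprime_def)
  qed
  have coprime_add: "coprime (i + n * x) d \<longleftrightarrow> coprime i d" for i x
    by (metis coprime_mod mod_mult_self2)
  let ?T = "coprime_triples (m * n) d" and ?C = "coprime_triples n d"
  let ?P = "\<lambda>(i, j, k). i mod n + j mod n + k mod n = n"
  let ?g = "\<lambda>(i, j, k). f i j k"
  have lt: "a < n" "b < n" "c < n" "0 < a" "0 < b" "0 < c" "a + b + c = n"
    if "(a, b, c) \<in> ?C" for a b c
    using that by (auto simp: coprime_triples_def coprimes_def)
  \<comment> \<open>The sum of the residues is a multiple of \<open>n\<close> strictly between 0 and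
    \<open>3 * n\<close>.\<close>
  have not_P: "i mod n + j mod n + k mod n = 2 * n" if "(i, j, k) \<in> ?T" "\<not> ?P (i, j, k)" for i j k
  proof -
    let ?r = "i mod n + j mod n + k mod n"
    have "?r mod n = (i + j + k) mod n" by (metis mod_add_eq mod_add_left_eq mod_add_right_eq)
    also have "\<dots> = 0" using that(1) by (simp add: coprime_triples_def)
    finally obtain e where e: "?r = n * e" by auto
    have "0 < ?r" using that(1) mod_pos by (simp add: coprime_triples_def coprimes_def)
    moreover have "?r < n * 3"
      using mod_less_divisor[OF assms(3), of i] mod_less_divisor[OF assms(3), of j]
        mod_less_divisor[OF assms(3), of k] by linarith
    ultimately have "0 < e" "e < 3" using e by auto
    moreover have "e \<noteq> 1" using that(2) e by auto
    ultimately have "e = 2" by simp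
    then show ?thesis using e by simp
  qed
  have sum_div: "i div n + j div n + k div n + s = m"
    if "(i, j, k) \<in> ?T" "i mod n + j mod n + k mod n = s * n" for i j k s
  proof -
    have "n * m = i + j + k" using that(1) by (simp add: coprime_triples_def mult.commute)
    also have "\<dots> = (n * (i div n) + i mod n) + (n * (j div n) + j mod n) + (n * (k div n) + k mod n)"
      by (simp only: mult_div_mod_eq)
    also have "\<dots> = n * (i div n + j div n + k div n) + (i mod n + j mod n + k mod n)"
      by (simp only: distrib_left add_ac)
    also have "\<dots> = n * (i div n + j div n + k div n + s)"
      unfolding that(2) by (simp add: distrib_left)
    finally show ?thesis using assms(3) by simp
  qed
  have "sum ?g ?T = sum ?g {t\<in>?T. ?P t} + sum ?g {t\<in>?T. \<not> ?P t}"
    by (subst sum.union_disjoint[symmetric]) (auto intro!: sum.cong)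
  also have "sum ?g {t\<in>?T. ?P t}
      = (\<Sum>((a, b, c), (x, y, z))\<in>?C \<times> weak_triples 1 m. f (a + n * x) (b + n * y) (c + n * z))"
  proof (rule sum.reindex_bij_witness[of _
        "\<lambda>((a, b, c), (x, y, z)). (a + n * x, b + n * y, c + n * z)"
        "\<lambda>(i, j, k). ((i mod n, j mod n, k mod n), (i div n, j div n, k div n))"])
    fix u assume "u \<in> {t\<in>?T. ?P t}"
    then obtain i j k where u: "u = (i, j, k)" "(i, j, k) \<in> ?T" "i mod n + j mod n + k mod n = n"
      by auto
    then show "(case u of (i, j, k) \<Rightarrow> ((i mod n, j mod n, k mod n), (i div n, j div n, k div n)))
        \<in> ?C \<times> weak_triples 1 m"
      using sum_div[of i j k 1]
      by (auto simp: coprime_triples_def coprimes_def weak_triples_def coprime_mod mod_pos)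
  next
    fix v assume "v \<in> ?C \<times> weak_triples 1 m"
    then obtain a b c x y z where v: "v = ((a, b, c), (x, y, z))" "(a, b, c) \<in> ?C"
      "x + y + z + 1 = m" by (auto simp: weak_triples_def)
    have "a + n * x + (b + n * y) + (c + n * z) = m * n"
      using lt(7)[OF v(2)] unfolding v(3)[symmetric] by (simp add: algebra_simps)
    then show "((\<lambda>((a, b, c), (x, y, z)). (a + n * x, b + n * y, c + n * z)) v) \<in> {t\<in>?T. ?P t}"
      using v(1,2) lt[OF v(2)]
      by (auto simp: coprime_triples_def coprimes_def coprime_add)
    show "(case ((\<lambda>((a, b, c), (x, y, z)). (a + n * x, b + n * y, c + n * z)) v) of
        (i, j, k) \<Rightarrow> ((i mod n, j mod n, k mod n), (i div n, j div n, k div n))) = v"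
      using v(1) lt[OF v(2)] by simp
  qed auto
  \<comment> \<open>Reflecting each residue turns the residue sum \<open>2 * n\<close> into
    \<open>3 * n - 2 * n = n\<close>, so the reflected triple lies in
    \<open>coprime_triples n d\<close>.\<close>
  also have "sum ?g {t\<in>?T. \<not> ?P t}
      = (\<Sum>((a, b, c), (x, y, z))\<in>?C \<times> weak_triples 2 m.
           f (n - a + n * x) (n - b + n * y) (n - c + n * z))"
  proof (rule sum.reindex_bij_witness[of _
        "\<lambda>((a, b, c), (x, y, z)). (n - a + n * x, n - b + n * y, n - c + n * z)"
        "\<lambda>(i, j, k). ((n - i mod n, n - j mod n, n - k mod n), (i div n, j div n, k div n))"])
    fix u assume "u \<in> {t\<in>?T. \<not> ?P t}"
    then obtain i j k where u: "u = (i, j, k)" "(i, j, k) \<in> ?T" "i mod n + j mod n + k mod n = 2 * n"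
      using not_P by blast
    have le: "r mod n < n" for r using assms(3) by simp
    have "n - i mod n + (n - j mod n) + (n - k mod n) = n"
      using u(3) le[of i] le[of j] le[of k] by linarith
    then show "(case u of (i, j, k) \<Rightarrow> ((n - i mod n, n - j mod n, n - k mod n), (i div n, j div n, k div n)))
        \<in> ?C \<times> weak_triples 2 m"
      using u(1,2) sum_div[OF u(2,3)] le
      by (auto simp: coprime_triples_def coprimes_def weak_triples_def coprime_mod coprime_refl less_imp_le)
    have restore: "n - (n - r mod n) + n * (r div n) = r" for r
      using le[of r] by (simp add: less_imp_le)
    show "(\<lambda>((a, b, c), (x, y, z)). (n - a + n * x, n - b + n * y, n - c + n * z))
        (case u of (i, j, k) \<Rightarrow> ((n - i mod n, n - j mod n, n - k mod n), (i div n, j div n, k div n))) = u"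
      using u(1) restore by simp
    show "(\<lambda>((a, b, c), (x, y, z)). f (n - a + n * x) (n - b + n * y) (n - c + n * z))
        (case u of (i, j, k) \<Rightarrow> ((n - i mod n, n - j mod n, n - k mod n), (i div n, j div n, k div n))) = ?g u"
      using u(1) restore by simp
  next
    fix v assume "v \<in> ?C \<times> weak_triples 2 m"
    then obtain a b c x y z where v: "v = ((a, b, c), (x, y, z))" "(a, b, c) \<in> ?C"
      "x + y + z + 2 = m" by (auto simp: weak_triples_def)
    note bounds = lt[OF v(2)]
    have residues: "n - a + (n - b) + (n - c) = 2 * n" using bounds by linarith
    have "n - a + n * x + (n - b + n * y) + (n - c + n * z)
        = (n - a + (n - b) + (n - c)) + n * (x + y + z)" by (simp add: algebra_simps)
    also have "\<dots> = m * n"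
      unfolding residues v(3)[symmetric] by (simp add: algebra_simps)
    finally have total: "n - a + n * x + (n - b + n * y) + (n - c + n * z) = m * n" .
    have summand: "0 < n - r + n * w" "coprime (n - r + n * w) d" "(n - r + n * w) mod n = n - r"
      if "coprime r d" "0 < r" "r < n" for r w
      using that unfolding mod_mult_self2 coprime_add by (simp_all add: coprime_refl)
    have "coprime a d" "coprime b d" "coprime c d"
      using v(2) by (simp_all add: coprime_triples_def coprimes_def)
    then show "((\<lambda>((a, b, c), (x, y, z)). (n - a + n * x, n - b + n * y, n - c + n * z)) v)
        \<in> {t\<in>?T. \<not> ?P t}"
      using total residues summand bounds(1-6) assms(3) unfolding v(1)
      by (simp add: coprime_triples_def coprimes_def add_ac)
    show "(case ((\<lambda>((a, b, c), (x, y, z)). (n - a + n * x, n - b + n * y, n - c + n * z)) v) of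
        (i, j, k) \<Rightarrow> ((n - i mod n, n - j mod n, n - k mod n), (i div n, j div n, k div n))) = v"
    proof -
      have "n - (n - r + n * w) mod n = r" "(n - r + n * w) div n = w" if "0 < r" "r < n" for r w
        using that div_mult_self2[of n "n - r" w] unfolding mod_mult_self2 by simp_all
      then show ?thesis using bounds(1-6) unfolding v(1) by (simp only: prod.case)
    qed
  qed
  finally show ?thesis
    by (simp add: sum.cartesian_product split_def sum.distrib)
qed

section \<open>Symmetry, common divisors and signs\<close>

lemma sum_coprime_triples_swap:
  fixes f :: "nat \<Rightarrow> nat \<Rightarrow> nat \<Rightarrow> 'a::comm_monoid_add"
  shows "(\<Sum>(i, j, k)\<in>coprime_triples N d. f j i k) = (\<Sum>(i, j, k)\<in>coprime_triples N d. f i j k)"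
    and "(\<Sum>(i, j, k)\<in>coprime_triples N d. f k j i) = (\<Sum>(i, j, k)\<in>coprime_triples N d. f i j k)"
  by (rule sum.reindex_bij_witness[of _ "\<lambda>(i, j, k). (j, i, k)" "\<lambda>(i, j, k). (j, i, k)"];
      auto simp: coprime_triples_def)
    (rule sum.reindex_bij_witness[of _ "\<lambda>(i, j, k). (k, j, i)" "\<lambda>(i, j, k). (k, j, i)"];
      auto simp: coprime_triples_def)

text \<open>If \<open>c\<close> divides two entries and the total, it divides the third. Dividing
  all three by \<open>c\<close> accounts for \<open>c ^ 3\<close> and preserves coprimality to
  \<open>d\<close>.\<close>

lemma triple_sum_multiples:
  assumes "coprime c d" "c > 0"
  shows "(\<Sum>(i, j, k)\<in>coprime_triples (c * N) d.
            if c dvd i \<and> c dvd j then 1 / (of_nat i * of_nat j * of_nat k) else 0)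
         = triple_sum N d / of_nat c ^ 3"
proof -
  have "(\<Sum>(i, j, k)\<in>coprime_triples (c * N) d.
            if c dvd i \<and> c dvd j then 1 / (of_nat i * of_nat j * of_nat k) else 0)
      = (\<Sum>(i, j, k)\<in>{(i, j, k)\<in>coprime_triples (c * N) d. c dvd i \<and> c dvd j}.
            1 / (of_nat i * of_nat j * of_nat k) :: rat)"
    by (rule sum.mono_neutral_cong_right) (auto split: if_splits)
  also have "\<dots> = (\<Sum>(i, j, k)\<in>coprime_triples N d. 1 / (of_nat (c * i) * of_nat (c * j) * of_nat (c * k)))"
  proof (rule sum.reindex_bij_witness[of _ "\<lambda>(i, j, k). (c * i, c * j, c * k)"
        "\<lambda>(i, j, k). (i div c, j div c, k div c)"])
    fix t assume "t \<in> {(i, j, k)\<in>coprime_triples (c * N) d. c dvd i \<and> c dvd j}"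
    then obtain i j k where t: "t = (i, j, k)" "(i, j, k) \<in> coprime_triples (c * N) d" "c dvd i" "c dvd j"
      by auto
    then have sum_eq: "i + j + k = c * N" by (simp add: coprime_triples_def)
    have "c dvd (i + j) + k" "c dvd i + j" using t(3,4) unfolding sum_eq by simp_all
    then have "c dvd k" by (simp only: dvd_add_right_iff)
    then obtain i' j' k' where ijk: "i = c * i'" "j = c * j'" "k = c * k'"
      using t(3,4) by (auto elim!: dvdE)
    moreover have "i' + j' + k' = N"
      using sum_eq assms(2) unfolding ijk by (simp flip: distrib_left)
    ultimately show "(case t of (i, j, k) \<Rightarrow> (i div c, j div c, k div c)) \<in> coprime_triples N d"
      "(case case t of (i, j, k) \<Rightarrow> (i div c, j div c, k div c) of (i, j, k) \<Rightarrow> (c * i, c * j, c * k)) = t"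
      "(case case t of (i, j, k) \<Rightarrow> (i div c, j div c, k div c) of
         (i, j, k) \<Rightarrow> 1 / (of_nat (c * i) * of_nat (c * j) * of_nat (c * k)))
       = (case t of (i, j, k) \<Rightarrow> (1 / (of_nat i * of_nat j * of_nat k) :: rat))"
      using t(1,2) assms(2) by (simp_all add: coprime_triples_def coprimes_def)
  next
    fix t assume "t \<in> coprime_triples N d"
    then obtain i j k where t: "t = (i, j, k)" "(i, j, k) \<in> coprime_triples N d"
      by (cases t) auto
    have "c * i + c * j + c * k = c * N"
      using t(2) by (auto simp: coprime_triples_def algebra_simps)
    then show "(case t of (i, j, k) \<Rightarrow> (c * i, c * j, c * k))
        \<in> {(i, j, k)\<in>coprime_triples (c * N) d. c dvd i \<and> c dvd j}"
      using t assms by (simp add: coprime_triples_def coprimes_def)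
    show "(case case t of (i, j, k) \<Rightarrow> (c * i, c * j, c * k) of (i, j, k) \<Rightarrow> (i div c, j div c, k div c)) = t"
      using t(1) assms(2) by simp
  qed
  also have "\<dots> = triple_sum N d / of_nat c ^ 3"
    unfolding triple_sum_def sum_divide_distrib
    by (intro sum.cong refl) (auto simp: power3_eq_cube mult_ac)
  finally show ?thesis .
qed

text \<open>Since \<open>i + j + k\<close> is even, either all three summands are even or exactly one is;
  averaging over the position of the sign therefore yields \<open>4 [i, j even] - 1\<close>.\<close>
lemma alternating_triple_sum:
  assumes "odd d"
  shows "3 * (\<Sum>(i, j, k)\<in>coprime_triples (2 * N) d. (-1) ^ i / (of_nat i * of_nat j * of_nat k))
    = triple_sum N d / 2 - triple_sum (2 * N) d"
proof -
  let ?T = "coprime_triples (2 * N) d"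
  let ?f = "\<lambda>i j k. 1 / (of_nat i * of_nat j * of_nat k) :: rat"
  let ?S = "\<Sum>(i, j, k)\<in>?T. (-1) ^ i / (of_nat i * of_nat j * of_nat k) :: rat"
  have "?S = (\<Sum>(i, j, k)\<in>?T. (-1) ^ j / (of_nat i * of_nat j * of_nat k))"
    using sum_coprime_triples_swap(1)[of "\<lambda>i j k. (-1) ^ i / (of_nat i * of_nat j * of_nat k) :: rat"]
    by (simp add: mult_ac)
  moreover have "?S = (\<Sum>(i, j, k)\<in>?T. (-1) ^ k / (of_nat i * of_nat j * of_nat k))"
    using sum_coprime_triples_swap(2)[of "\<lambda>i j k. (-1) ^ i / (of_nat i * of_nat j * of_nat k) :: rat"]
    by (simp add: mult_ac)
  ultimately have "3 * ?S = (\<Sum>(i, j, k)\<in>?T. (-1) ^ i / (of_nat i * of_nat j * of_nat k))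
      + (\<Sum>(i, j, k)\<in>?T. (-1) ^ j / (of_nat i * of_nat j * of_nat k))
      + (\<Sum>(i, j, k)\<in>?T. (-1) ^ k / (of_nat i * of_nat j * of_nat k))"
    by linarith
  also have "\<dots> = (\<Sum>(i, j, k)\<in>?T. 4 * (if 2 dvd i \<and> 2 dvd j then ?f i j k else 0) - ?f i j k)"
    unfolding sum.distrib[symmetric]
  proof (intro sum.cong refl)
    fix t assume "t \<in> ?T"
    then obtain i j k where t: "t = (i, j, k)" "i + j + k = 2 * N"
      by (auto simp: coprime_triples_def)
    then have "even (i + j + k)" by simp
    then have "even k \<longleftrightarrow> (even i \<longleftrightarrow> even j)" by auto
    then show "(case t of (i, j, k) \<Rightarrow> (-1) ^ i / (of_nat i * of_nat j * of_nat k))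
        + (case t of (i, j, k) \<Rightarrow> (-1) ^ j / (of_nat i * of_nat j * of_nat k))
        + (case t of (i, j, k) \<Rightarrow> (-1) ^ k / (of_nat i * of_nat j * of_nat k))
        = (case t of (i, j, k) \<Rightarrow> 4 * (if 2 dvd i \<and> 2 dvd j then ?f i j k else 0) - ?f i j k)"
      unfolding t(1) by (cases "even i"; cases "even j") simp_all
  qed
  also have "\<dots> = 4 * (\<Sum>(i, j, k)\<in>?T. if 2 dvd i \<and> 2 dvd j then ?f i j k else 0) - triple_sum (2 * N) d"
    by (simp add: triple_sum_def split_def sum_subtractf sum_distrib_left)
  also have "\<dots> = 4 * (triple_sum N d / 2 ^ 3) - triple_sum (2 * N) d"
    using triple_sum_multiples[of 2 d N] assms by (simp only: of_nat_numeral) simp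
  finally show ?thesis by simp
qed

section \<open>Multiplying the total: first-order expansion\<close>

lemma sum_affine_weak_triples:
  fixes r s t u v w :: rat
  shows "(\<Sum>(x, y, z)\<in>weak_triples e m. v * (w + u * (of_nat x * r + of_nat y * s + of_nat z * t))) =
     v * (of_nat (card (weak_triples e m)) * w + u * ((\<Sum>(x, y, z)\<in>weak_triples e m. of_nat x) * (r + s + t)))"
  unfolding sum_linear_weak_triples[symmetric]
  by (simp add: split_def sum_distrib_left sum.distrib distrib_left)

text \<open>Up to sign, each summand is the derivative of \<open>1 / (i * j * k)\<close> when all
  three entries are shifted by the same amount.\<close>

definition weighted_triple_sum :: "nat \<Rightarrow> nat \<Rightarrow> rat" where
  "weighted_triple_sum N d = (\<Sum>(i, j, k)\<in>coprime_triples N d.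
     1 / (of_nat i * of_nat j * of_nat k) * (1 / of_nat i + 1 / of_nat j + 1 / of_nat k))"

context prime_modulus
begin

lemma not_dvd_coprimes:
  assumes "i \<in> coprimes d" "p dvd d"
  shows "\<not> p dvd i"
proof
  assume "p dvd i"
  then have "is_unit p" using assms coprime_common_divisor[of i d p] by (simp add: coprimes_def)
  then show False using prime_p by auto
qed

text \<open>For one factor the error is exactly
  \<open>N ^ 2 * x ^ 2 / (t ^ 2 * (t + N * x))\<close>, and \<open>N ^ 2\<close> carries
  \<open>p ^ (2 * a)\<close>. Rational entries cover the negative ones that reflected residues
  produce.\<close>

lemma triple_inverse_first_order:
  fixes N :: rat
  assumes "N = of_nat p ^ a * w" "w \<in> p_integral p"
    and nz: "t1 \<noteq> 0" "t2 \<noteq> 0" "t3 \<noteq> 0" "t1 + N * x1 \<noteq> 0" "t2 + N * x2 \<noteq> 0" "t3 + N * x3 \<noteq> 0"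
    and inv: "1 / t1 \<in> p_integral p" "1 / t2 \<in> p_integral p" "1 / t3 \<in> p_integral p"
      "1 / (t1 + N * x1) \<in> p_integral p" "1 / (t2 + N * x2) \<in> p_integral p"
      "1 / (t3 + N * x3) \<in> p_integral p"
    and x: "x1 \<in> p_integral p" "x2 \<in> p_integral p" "x3 \<in> p_integral p"
  shows "rat_cong p (2 * a) (1 / ((t1 + N * x1) * (t2 + N * x2) * (t3 + N * x3)))
    (1 / (t1 * t2 * t3) * (1 - N * (x1 / t1 + x2 / t2 + x3 / t3)))"
proof -
  have N: "N \<in> p_integral p"
    unfolding assms(1) by (intro p_integral_mult p_integral_power p_integral_of_nat assms(2))
  have N2: "N ^ 2 = of_nat p ^ (2 * a) * w ^ 2"
    unfolding assms(1) by (simp add: power_mult_distrib power_mult[symmetric] mult.commute)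
  have one: "rat_cong p (2 * a) (1 / (t + N * x)) (1 / t * (1 - N * x * (1 / t)))"
    if "t \<noteq> 0" "t + N * x \<noteq> 0" "1 / t \<in> p_integral p" "1 / (t + N * x) \<in> p_integral p" "x \<in> p_integral p"
    for t x
  proof (rule rat_congI)
    show "w ^ 2 * (x ^ 2 * (1 / t) ^ 2 * (1 / (t + N * x))) \<in> p_integral p"
      using that assms(2) by (intro p_integral_mult p_integral_power)
    have "1 / (t + N * x) - 1 / t * (1 - N * x * (1 / t)) = N ^ 2 * (x ^ 2 * (1 / t) ^ 2 * (1 / (t + N * x)))"
      using that(1,2) by (simp add: divide_simps) (simp add: algebra_simps power2_eq_square)
    then show "1 / (t + N * x) - 1 / t * (1 - N * x * (1 / t))
        = of_nat p ^ (2 * a) * (w ^ 2 * (x ^ 2 * (1 / t) ^ 2 * (1 / (t + N * x))))"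
      unfolding N2 by (simp only: mult.assoc)
  qed
  have step: "1 / t * (1 - N * x * (1 / t)) \<in> p_integral p"
    if "1 / t \<in> p_integral p" "x \<in> p_integral p" for t x
    using that N by (intro p_integral_mult p_integral_diff p_integral_1)
  define v1 v2 v3 where v: "v1 = 1 / t1" "v2 = 1 / t2" "v3 = 1 / t3"
  have v_int: "v1 \<in> p_integral p" "v2 \<in> p_integral p" "v3 \<in> p_integral p" using inv(1-3) v by simp_all
  \<comment> \<open>\<open>N ^ 2 * ?e\<close> collects the quadratic and cubic terms of the product
    of the three expansions.\<close>
  let ?e = "v1 * v2 * v3 * (x1 * x2 * v1 * v2 + x1 * x3 * v1 * v3 + x2 * x3 * v2 * v3
      - N * (x1 * x2 * x3 * v1 * v2 * v3))"
  have "1 / ((t1 + N * x1) * (t2 + N * x2) * (t3 + N * x3))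
      = 1 / (t1 + N * x1) * (1 / (t2 + N * x2)) * (1 / (t3 + N * x3))"
    by simp
  also have "rat_cong p (2 * a) \<dots> (v1 * (1 - N * x1 * v1) * (v2 * (1 - N * x2 * v2)) * (v3 * (1 - N * x3 * v3)))"
    unfolding v using inv x
    by (intro rat_cong_mult one nz step p_integral_mult) assumption+
  also have "v1 * (1 - N * x1 * v1) * (v2 * (1 - N * x2 * v2)) * (v3 * (1 - N * x3 * v3))
      = v1 * v2 * v3 * (1 - N * (x1 * v1 + x2 * v2 + x3 * v3)) + N ^ 2 * ?e"
    by (simp add: algebra_simps power2_eq_square)
  also have "rat_cong p (2 * a) \<dots> (v1 * v2 * v3 * (1 - N * (x1 * v1 + x2 * v2 + x3 * v3)) + 0)"
    unfolding N2 mult.assoc[of "of_nat p ^ (2 * a)"] using v_int x N assms(2)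
    by (intro rat_cong_add rat_cong_refl rat_cong_0I p_integral_mult p_integral_power
        p_integral_diff p_integral_add)
  finally show ?thesis by (simp add: v)
qed

text \<open>Both blocks of \<open>sum_coprime_triples_mult\<close> are expanded to first order. The
  leading terms leave the difference of the two counts, which is \<open>m\<close>; the linear terms
  add up to \<open>K\<close>. As a natural number, \<open>K\<close> is integral even for
  \<open>p = 3\<close>.\<close>

lemma triple_sum_mult_cong:
  assumes "p dvd d" "d dvd n" "p ^ a dvd n" "n > 0"
  obtains K :: nat where "3 * of_nat K = (of_nat m * (of_nat m ^ 2 - 1) :: rat)"
    "rat_cong p (2 * a) (triple_sum (m * n) d)
       (of_nat m * triple_sum n d - of_nat n * of_nat K * weighted_triple_sum n d)"
proof -
  define X where "X s = (\<Sum>(x, y, z)\<in>weak_triples s m. x)" for s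
  define C where "C s = card (weak_triples s m)" for s
  \<comment> \<open>The second block is expanded around \<open>- i\<close>, as
    \<open>n - i + n * x = - i + n * (x + 1)\<close>. Its linear term sums \<open>x + 1\<close>
    instead of \<open>x\<close>, whence \<open>X 2 + C 2\<close>.\<close>
  define K where "K = X 1 + X 2 + C 2"
  have of_nat_X: "(\<Sum>(x, y, z)\<in>weak_triples s m. of_nat x) = (of_nat (X s) :: rat)" for s
    by (simp add: X_def split_def)
  have X: "6 * of_nat (X 1) = ((of_nat m - 1) * of_nat m * (of_nat m + 1) :: rat)"
    "6 * of_nat (X 2) = ((of_nat m - 2) * (of_nat m - 1) * of_nat m :: rat)"
    using first_sum_weak_triples_1[of m] first_sum_weak_triples_2[of m] unfolding of_nat_X .
  have C: "2 * of_nat (C 1) = (of_nat m * (of_nat m + 1) :: rat)"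
    "2 * of_nat (C 2) = (of_nat m * (of_nat m - 1) :: rat)"
    using card_weak_triples_1[of m] card_weak_triples_2[of m] unfolding C_def .
  have C_diff: "of_nat (C 1) - of_nat (C 2) = (of_nat m :: rat)"
    using C by (simp add: algebra_simps)
  have K: "3 * of_nat K = (of_nat m * (of_nat m ^ 2 - 1) :: rat)"
    using X C unfolding K_def by (simp add: algebra_simps power2_eq_square)
  obtain w where n_eq: "n = p ^ a * w" using assms(3) by blast
  have "d \<noteq> 1" using assms(1) prime_p by auto
  define N where "N = (of_nat n :: rat)"
  have N: "N = of_nat p ^ a * of_nat w" unfolding N_def n_eq by simp
  have expand: "triple_sum (m * n) d = (\<Sum>(i, j, k)\<in>coprime_triples n d.
       (\<Sum>(x, y, z)\<in>weak_triples 1 m. 1 / (of_nat (i + n * x) * of_nat (j + n * y) * of_nat (k + n * z)))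
     + (\<Sum>(x, y, z)\<in>weak_triples 2 m.
          1 / (of_nat (n - i + n * x) * of_nat (n - j + n * y) * of_nat (n - k + n * z))))"
    (is "_ = ?lhs")
    unfolding triple_sum_def
    by (rule sum_coprime_triples_mult[OF assms(2) \<open>d \<noteq> 1\<close> assms(4),
          of "\<lambda>i j k. 1 / (of_nat i * of_nat j * of_nat k)"])
  have cong: "rat_cong p (2 * a) ?lhs (\<Sum>(i, j, k)\<in>coprime_triples n d.
      of_nat m * (1 / (of_nat i * of_nat j * of_nat k))
      - N * of_nat K * (1 / (of_nat i * of_nat j * of_nat k) * (1 / of_nat i + 1 / of_nat j + 1 / of_nat k)))"
    (is "rat_cong _ _ _ ?rhs")
  proof (rule rat_cong_sum)
    fix t assume "t \<in> coprime_triples n d"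
    then obtain i j k where t: "t = (i, j, k)" "i \<in> coprimes d" "j \<in> coprimes d" "k \<in> coprimes d"
      "i + j + k = n" by (auto simp: coprime_triples_def)
    have not_dvd: "\<not> p dvd i" "\<not> p dvd j" "\<not> p dvd k"
      using t(2-4) assms(1) not_dvd_coprimes by blast+
    have pos: "0 < i" "0 < j" "0 < k" using t(2-4) by (simp_all add: coprimes_def)
    have dvd_n: "p dvd n" using assms(1,2) by (rule dvd_trans)
    have shift: "\<not> p dvd r + n * x" "\<not> p dvd n - r + n * x" if "\<not> p dvd r" "r \<le> n" for r x
    proof -
      have "p dvd n * x" using dvd_n by simp
      then show "\<not> p dvd r + n * x" "\<not> p dvd n - r + n * x"
        using that dvd_n by (auto simp: dvd_add_left_iff dest: dvd_diffD1)
    qed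
    let ?v = "1 / (of_nat i * of_nat j * of_nat k) :: rat"
    let ?u = "1 / of_nat i + 1 / of_nat j + 1 / of_nat k :: rat"
    have v_int: "1 / of_nat i \<in> p_integral p" "1 / of_nat j \<in> p_integral p" "1 / of_nat k \<in> p_integral p"
      using not_dvd by (simp_all add: p_integral_inverse)
    have first: "rat_cong p (2 * a) (1 / (of_nat (i + n * x) * of_nat (j + n * y) * of_nat (k + n * z)))
        (?v * (1 - N * (of_nat x * (1 / of_nat i) + of_nat y * (1 / of_nat j) + of_nat z * (1 / of_nat k))))"
      for x y z
    proof -
      have int: "1 / (of_nat r + N * of_nat x) \<in> p_integral p" if "\<not> p dvd r" "r \<le> n" for r x
        using p_integral_inverse[OF shift(1)[OF that, of x]] by (simp add: N_def)
      have nz: "of_nat r + N * of_nat x \<noteq> 0" if "0 < r" for r x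
      proof -
        have "of_nat (r + n * x) \<noteq> (0::rat)" using that by (simp only: of_nat_eq_0_iff)
        then show ?thesis by (simp add: N_def)
      qed
      have le: "i \<le> n" "j \<le> n" "k \<le> n" using t(5) by auto
      have "rat_cong p (2 * a)
          (1 / ((of_nat i + N * of_nat x) * (of_nat j + N * of_nat y) * (of_nat k + N * of_nat z)))
          (?v * (1 - N * (of_nat x / of_nat i + of_nat y / of_nat j + of_nat z / of_nat k)))"
        using pos le by (intro triple_inverse_first_order[OF N] int nz v_int not_dvd p_integral_of_nat) auto
      then show ?thesis by (simp add: N_def)
    qed
    \<comment> \<open>Reflection flips the sign of the product and again that of the linear term
      relative to it, so the linear terms of the two blocks reinforce each other while the leading
      terms are subtracted.\<close>
    have second: "rat_cong p (2 * a) (1 / (of_nat (n - i + n * x) * of_nat (n - j + n * y) * of_nat (n - k + n * z)))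
        (- ?v * (1 + N * (of_nat (Suc x) * (1 / of_nat i) + of_nat (Suc y) * (1 / of_nat j)
           + of_nat (Suc z) * (1 / of_nat k))))"
      for x y z
    proof -
      have eq: "of_nat (n - r + n * x) = - of_nat r + N * of_nat (Suc x)" if "r \<le> n" for r x
        using that by (simp add: N_def of_nat_diff algebra_simps)
      have le: "i \<le> n" "j \<le> n" "k \<le> n" using t(5) by auto
      have int: "1 / (- of_nat r + N * of_nat (Suc x)) \<in> p_integral p" if "\<not> p dvd r" "r \<le> n" for r x
        using p_integral_inverse[OF shift(2)[OF that, of x]] unfolding eq[OF that(2)] .
      have nz: "- of_nat r + N * of_nat (Suc x) \<noteq> 0" if "0 < r" "r < n" for r x
      proof -
        have "of_nat (n - r + n * x) \<noteq> (0::rat)" using that by (simp only: of_nat_eq_0_iff)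
        then show ?thesis unfolding eq[OF less_imp_le[OF that(2)]] .
      qed
      have neg_int: "1 / - of_nat r \<in> p_integral p" if "1 / of_nat r \<in> p_integral p" for r
        using p_integral_uminus[OF that] by simp
      have "rat_cong p (2 * a)
          (1 / ((- of_nat i + N * of_nat (Suc x)) * (- of_nat j + N * of_nat (Suc y)) * (- of_nat k + N * of_nat (Suc z))))
          (1 / (- of_nat i * - of_nat j * - of_nat k)
            * (1 - N * (of_nat (Suc x) / - of_nat i + of_nat (Suc y) / - of_nat j + of_nat (Suc z) / - of_nat k)))"
        using pos le t(5) by (intro triple_inverse_first_order[OF N] int nz neg_int v_int not_dvd p_integral_of_nat) auto
      moreover have "1 / (- a * - b * - c) * (1 - N * (x / - a + y / - b + z / - c))
          = - (1 / (a * b * c)) * (1 + N * (x * (1 / a) + y * (1 / b) + z * (1 / c)))" for a b c x y z :: rat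
        by (simp add: algebra_simps)
      ultimately show ?thesis unfolding eq[OF le(1)] eq[OF le(2)] eq[OF le(3)] by (simp only:)
    qed
    have "rat_cong p (2 * a)
       ((\<Sum>(x, y, z)\<in>weak_triples 1 m. 1 / (of_nat (i + n * x) * of_nat (j + n * y) * of_nat (k + n * z)))
       + (\<Sum>(x, y, z)\<in>weak_triples 2 m.
          1 / (of_nat (n - i + n * x) * of_nat (n - j + n * y) * of_nat (n - k + n * z))))
       ((\<Sum>(x, y, z)\<in>weak_triples 1 m.
          ?v * (1 - N * (of_nat x * (1 / of_nat i) + of_nat y * (1 / of_nat j) + of_nat z * (1 / of_nat k))))
       + (\<Sum>(x, y, z)\<in>weak_triples 2 m.
          - ?v * (1 + N * (of_nat (Suc x) * (1 / of_nat i) + of_nat (Suc y) * (1 / of_nat j)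
           + of_nat (Suc z) * (1 / of_nat k)))))" (is "rat_cong _ _ _ (?A + ?B)")
      unfolding split_def by (intro rat_cong_add rat_cong_sum first second)
    also have "?A = ?v * (of_nat (C 1) - N * (of_nat (X 1) * ?u))"
      using sum_affine_weak_triples[where w = 1 and u = "- N" and v = ?v and e = 1 and m = m
          and r = "1 / of_nat i" and s = "1 / of_nat j" and t = "1 / of_nat k"]
      unfolding of_nat_X C_def[symmetric] by simp
    also have "?B = - ?v * (of_nat (C 2) + N * ((of_nat (X 2) + of_nat (C 2)) * ?u))"
    proof -
      \<comment> \<open>Splitting \<open>Suc x\<close> into \<open>x + 1\<close> moves
        \<open>N * (r + s + t)\<close> into the constant part of the affine sum.\<close>
      have "- v * (1 + N * (of_nat (Suc x) * r + of_nat (Suc y) * s + of_nat (Suc z) * t))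
          = - v * ((1 + N * (r + s + t)) + N * (of_nat x * r + of_nat y * s + of_nat z * t))"
        for v r s t :: rat and x y z
        by (simp add: algebra_simps)
      then have "?B = (\<Sum>(x, y, z)\<in>weak_triples 2 m. - ?v * ((1 + N * ?u)
          + N * (of_nat x * (1 / of_nat i) + of_nat y * (1 / of_nat j) + of_nat z * (1 / of_nat k))))"
        by (simp only:)
      also have "\<dots> = - ?v * (of_nat (C 2) * (1 + N * ?u) + N * (of_nat (X 2) * ?u))"
        unfolding sum_affine_weak_triples of_nat_X C_def[symmetric] ..
      also have "- v * (c * (1 + N * u) + N * (x * u)) = - v * (c + N * ((x + c) * u))"
        for v c x u :: rat by (simp add: algebra_simps)
      finally show ?thesis .
    qed
    also have "?v * (of_nat (C 1) - N * (of_nat (X 1) * ?u))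
        + - ?v * (of_nat (C 2) + N * ((of_nat (X 2) + of_nat (C 2)) * ?u))
        = (of_nat (C 1) - of_nat (C 2)) * ?v - N * of_nat K * (?v * ?u)"
    proof -
      have "v * (c1 - N * (x1 * u)) + - v * (c2 + N * ((x2 + c2) * u))
          = (c1 - c2) * v - N * (x1 + x2 + c2) * (v * u)" for v u c1 c2 x1 x2 :: rat
        by (simp add: algebra_simps)
      then show ?thesis unfolding K_def of_nat_add .
    qed
    finally show "rat_cong p (2 * a)
       (case t of (i, j, k) \<Rightarrow>
       (\<Sum>(x, y, z)\<in>weak_triples 1 m. 1 / (of_nat (i + n * x) * of_nat (j + n * y) * of_nat (k + n * z)))
       + (\<Sum>(x, y, z)\<in>weak_triples 2 m.
          1 / (of_nat (n - i + n * x) * of_nat (n - j + n * y) * of_nat (n - k + n * z))))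
       (case t of (i, j, k) \<Rightarrow> of_nat m * (1 / (of_nat i * of_nat j * of_nat k))
      - N * of_nat K * (1 / (of_nat i * of_nat j * of_nat k) * (1 / of_nat i + 1 / of_nat j + 1 / of_nat k)))"
      unfolding t(1) prod.case C_diff .
  qed
  have "?rhs = of_nat m * triple_sum n d - of_nat n * of_nat K * weighted_triple_sum n d"
    by (simp add: triple_sum_def weighted_triple_sum_def split_def sum_subtractf sum_distrib_left N_def)
  with cong show ?thesis
    using that[OF K] unfolding expand by (simp only:)
qed


lemma p_integral_sum_coprime_triples:
  assumes "\<And>i j k. i \<in> coprimes d \<Longrightarrow> j \<in> coprimes d \<Longrightarrow> k \<in> coprimes d \<Longrightarrow> f i j k \<in> p_integral p"
  shows "(\<Sum>(i, j, k)\<in>coprime_triples N d. f i j k) \<in> p_integral p"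
  using assms by (intro p_integral_sum) (auto simp: coprime_triples_def)

lemma p_integral_inverse_triple:
  assumes "p dvd d" "i \<in> coprimes d" "j \<in> coprimes d" "k \<in> coprimes d"
  shows "1 / (of_nat i * of_nat j * of_nat k) \<in> p_integral p"
proof -
  have "1 / of_nat i * (1 / of_nat j) * (1 / of_nat k) \<in> p_integral p"
    by (intro p_integral_mult p_integral_inverse not_dvd_coprimes[OF _ assms(1)] assms)
  then show ?thesis by simp
qed

lemma p_integral_triple_sum:
  assumes "p dvd d"
  shows "triple_sum N d \<in> p_integral p" "weighted_triple_sum N d \<in> p_integral p"
  unfolding triple_sum_def weighted_triple_sum_def
  by (intro p_integral_sum_coprime_triples p_integral_mult p_integral_add p_integral_inverse
      p_integral_inverse_triple[OF assms] not_dvd_coprimes[OF _ assms]; assumption)+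

text \<open>Three residues prime to 3 whose sum is divisible by 3 are all equal.\<close>
lemma weighted_triple_sum_cong_0:
  assumes "p = 3" "p dvd d" "d dvd n"
  shows "rat_cong p 1 (weighted_triple_sum n d) 0"
proof -
  have "rat_cong p 1 (weighted_triple_sum n d) (\<Sum>t\<in>coprime_triples n d. 0)"
    unfolding weighted_triple_sum_def
  proof (rule rat_cong_sum)
    fix t assume "t \<in> coprime_triples n d"
    then obtain i j k where t: "t = (i, j, k)" "i \<in> coprimes d" "j \<in> coprimes d" "k \<in> coprimes d"
      "i + j + k = n" by (auto simp: coprime_triples_def)
    have not_dvd: "\<not> p dvd i" "\<not> p dvd j" "\<not> p dvd k"
      using t(2-4) assms(2) not_dvd_coprimes by blast+
    have "p dvd i + j + k" unfolding t(5) using assms(2,3) by (rule dvd_trans)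
    then have "j mod p = i mod p" "k mod p = i mod p"
      using not_dvd unfolding assms(1) by presburger+
    then have "rat_cong p 1 (1 / of_nat j) (1 / of_nat i)" "rat_cong p 1 (1 / of_nat k) (1 / of_nat i)"
      using not_dvd by (auto intro!: rat_cong_inverse rat_cong_of_nat simp: cong_def)
    then have "rat_cong p 1 (1 / of_nat i + 1 / of_nat j + 1 / of_nat k)
        (1 / of_nat i + 1 / of_nat i + 1 / of_nat i)"
      by (intro rat_cong_add rat_cong_refl)
    also have "1 / of_nat i + 1 / of_nat i + 1 / of_nat i = of_nat p ^ 1 * (1 / of_nat i :: rat)"
      by (simp add: assms(1))
    also have "rat_cong p 1 \<dots> 0"
      by (rule rat_cong_0I[OF p_integral_inverse[OF not_dvd(1)]])
    finally have "rat_cong p 1 (1 / of_nat i * (1 / of_nat j) * (1 / of_nat k) * (1 / of_nat i + 1 / of_nat j + 1 / of_nat k))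
        (1 / of_nat i * (1 / of_nat j) * (1 / of_nat k) * 0)"
      by (rule rat_cong_mult_left) (intro p_integral_mult p_integral_inverse not_dvd)
    then show "rat_cong p 1 (case t of (i, j, k) \<Rightarrow> 1 / (of_nat i * of_nat j * of_nat k)
        * (1 / of_nat i + 1 / of_nat j + 1 / of_nat k)) 0"
      unfolding t(1) by simp
  qed
  then show ?thesis by simp
qed

text \<open>The correction term carries the factor \<open>n\<close>, hence
  \<open>p ^ a\<close>.\<close>

lemma triple_sum_mult_cong_weak:
  assumes "p dvd d" "d dvd n" "p ^ a dvd n" "n > 0"
  shows "rat_cong p a (triple_sum (m * n) d) (of_nat m * triple_sum n d)"
proof -
  obtain K :: nat where K: "rat_cong p (2 * a) (triple_sum (m * n) d)
       (of_nat m * triple_sum n d - of_nat n * of_nat K * weighted_triple_sum n d)"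
    using triple_sum_mult_cong[OF assms] by metis
  obtain w where n: "n = p ^ a * w" using assms(3) by blast
  have "rat_cong p a (of_nat n * of_nat K * weighted_triple_sum n d) 0"
    using rat_cong_0I[of "of_nat w * of_nat K * weighted_triple_sum n d" a] p_integral_triple_sum(2)[OF assms(1)]
    by (simp add: n p_integral_mult mult.assoc)
  from rat_cong_trans[OF rat_cong_mono[OF K] rat_cong_diff[OF rat_cong_refl this]]
  show ?thesis by simp
qed

text \<open>One more power of \<open>p\<close> requires \<open>p\<close> to divide
  \<open>K * ?W\<close>: for \<open>p = 3\<close> through \<open>?W\<close>, otherwise through
  \<open>m\<close>, which divides \<open>3 * K\<close>. Positivity of \<open>a\<close> gives
  \<open>a + 1 \<le> 2 * a\<close>.\<close>

lemma triple_sum_mult_cong_strong: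
  assumes "p dvd d" "d dvd n" "p ^ a dvd n" "n > 0" "a > 0" "p = 3 \<or> p dvd m"
  shows "rat_cong p (a + 1) (triple_sum (m * n) d) (of_nat m * triple_sum n d)"
proof -
  obtain K :: nat where K: "3 * of_nat K = (of_nat m * (of_nat m ^ 2 - 1) :: rat)"
    "rat_cong p (2 * a) (triple_sum (m * n) d)
       (of_nat m * triple_sum n d - of_nat n * of_nat K * weighted_triple_sum n d)"
    using triple_sum_mult_cong[OF assms(1-4)] by metis
  let ?W = "weighted_triple_sum n d"
  have W: "?W \<in> p_integral p" using p_integral_triple_sum(2)[OF assms(1)] .
  have "rat_cong p 1 (of_nat K * ?W) 0"
  proof (cases "p = 3")
    case True
    then show ?thesis
      using rat_cong_mult_left[OF weighted_triple_sum_cong_0[OF True assms(1,2)] p_integral_of_nat, of K] by simp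
  next
    case False
    then obtain l where m: "m = p * l" using assms(6) by blast
    have "\<not> p dvd 3" using False prime_p primes_dvd_imp_eq[of p 3] by auto
    moreover have eq: "of_nat 3 * (of_nat K * ?W) = of_nat p ^ 1 * (of_nat l * (of_nat m ^ 2 - 1) * ?W)"
      using K(1) by (simp add: m flip: mult.assoc)
    have "rat_cong p 1 (of_nat 3 * (of_nat K * ?W)) (of_nat 3 * 0)"
      unfolding eq mult_zero_right
      by (intro rat_cong_0I p_integral_mult p_integral_diff p_integral_power p_integral_of_nat p_integral_1 W)
    ultimately show ?thesis by (blast intro: rat_cong_cancel)
  qed
  from rat_cong_scale[OF this, of a]
  have scaled: "rat_cong p (a + 1) (of_nat p ^ a * (of_nat K * ?W)) 0"
    by (simp add: add.commute)
  obtain w where n: "n = p ^ a * w" using assms(3) by blast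
  have "rat_cong p (a + 1) (of_nat n * of_nat K * ?W) 0"
    using rat_cong_mult_left[OF scaled, of "of_nat w"] by (simp add: n mult_ac)
  moreover have "a + 1 \<le> 2 * a" using assms(5) by simp
  ultimately show ?thesis
    using rat_cong_trans[OF rat_cong_mono[OF K(2)] rat_cong_diff[OF rat_cong_refl]] by fastforce
qed

section \<open>Evaluation of triple sums modulo \<open>p\<close>\<close>

text \<open>Writing the first entry as \<open>q * (p - i)\<close> leaves the total
  \<open>q * i\<close> for the other two. For \<open>q = 1\<close> the divisibility condition is
  void and the left-hand side is \<open>triple_sum p p\<close>.\<close>

lemma coprime_triples_multiple_sum:
  assumes "\<not> p dvd q"
  shows "(\<Sum>(i, j, k)\<in>coprime_triples (q * p) p. if q dvd i then 1 / (of_nat i * of_nat j * of_nat k) else 0)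
    = (\<Sum>i\<in>{1..<p}. \<Sum>j\<in>summands (q * i).
         1 / (of_nat (q * (p - i)) * of_nat j * of_nat (q * i - j)) :: rat)"
proof -
  have q_pos: "0 < q" using assms by (intro Nat.gr0I notI) simp
  have coprime_iff: "coprime i p \<longleftrightarrow> \<not> p dvd i" for i
    using prime_p by (metis coprime_commute prime_imp_coprime coprime_absorb_left not_prime_unit)
  have "(\<Sum>(i, j, k)\<in>coprime_triples (q * p) p. if q dvd i then 1 / (of_nat i * of_nat j * of_nat k) else 0)
      = (\<Sum>(i, j, k)\<in>{(i, j, k)\<in>coprime_triples (q * p) p. q dvd i}. 1 / (of_nat i * of_nat j * of_nat k) :: rat)"
    by (rule sum.mono_neutral_cong_right) (auto split: if_splits)
  also have "\<dots> = (\<Sum>(i, j)\<in>(SIGMA i:{1..<p}. summands (q * i)).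
      1 / (of_nat (q * (p - i)) * of_nat j * of_nat (q * i - j)))"
  proof (rule sum.reindex_bij_witness[of _ "\<lambda>(i, j). (q * (p - i), j, q * i - j)"
        "\<lambda>(i, j, k). (p - i div q, j)"])
    fix t assume "t \<in> {(i, j, k)\<in>coprime_triples (q * p) p. q dvd i}"
    then obtain e j k where t: "t = (q * e, j, k)" "(q * e, j, k) \<in> coprime_triples (q * p) p"
      by (auto elim!: dvdE)
    then have sum_eq: "q * e + j + k = q * p" and pos: "0 < q * e" "0 < j" "0 < k"
      and not_dvd: "\<not> p dvd j" "\<not> p dvd k"
      by (simp_all add: coprime_triples_def coprimes_def coprime_iff)
    have "q * e < q * p" using sum_eq pos by linarith
    then have e: "0 < e" "e < p" using pos by auto
    have diff: "q * (p - e) = j + k" using sum_eq by (simp add: diff_mult_distrib2)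
    show "(case t of (i, j, k) \<Rightarrow> (p - i div q, j)) \<in> (SIGMA i:{1..<p}. summands (q * i))"
      using e diff not_dvd pos q_pos by (simp add: t(1) summands_def)
    show "(\<lambda>(i, j). (q * (p - i), j, q * i - j)) (case t of (i, j, k) \<Rightarrow> (p - i div q, j)) = t"
      using e diff q_pos by (simp add: t(1))
    show "(\<lambda>(i, j). 1 / (of_nat (q * (p - i)) * of_nat j * of_nat (q * i - j)))
        (case t of (i, j, k) \<Rightarrow> (p - i div q, j))
        = (case t of (i, j, k) \<Rightarrow> (1 / (of_nat i * of_nat j * of_nat k) :: rat))"
      using e diff q_pos by (simp add: t(1))
  next
    fix u assume "u \<in> (SIGMA i:{1..<p}. summands (q * i))"
    then obtain i j where u: "u = (i, j)" "0 < i" "i < p" "j \<in> summands (q * i)" by auto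
    have "\<not> p dvd p - i" using u by (intro not_dvd_range) auto
    then have "\<not> p dvd q * (p - i)" using assms prime_p by (meson prime_dvd_mult_iff)
    moreover have "q * (p - i) + q * i = q * p"
      using u(3) by (simp flip: distrib_left)
    then have "q * (p - i) + j + (q * i - j) = q * p"
      using u(4) by (simp add: summands_def)
    ultimately show "(\<lambda>(i, j). (q * (p - i), j, q * i - j)) u
        \<in> {(i, j, k)\<in>coprime_triples (q * p) p. q dvd i}"
      using u q_pos by (simp add: coprime_triples_def coprimes_def coprime_iff summands_def)
    show "(case (\<lambda>(i, j). (q * (p - i), j, q * i - j)) u of (i, j, k) \<Rightarrow> (p - i div q, j)) = u"
      using u q_pos by simp
  qed
  also have "\<dots> = (\<Sum>i\<in>{1..<p}. \<Sum>j\<in>summands (q * i).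
         1 / (of_nat (q * (p - i)) * of_nat j * of_nat (q * i - j)))"
    by (rule sum.Sigma[symmetric]) simp_all
  finally show ?thesis .
qed

text \<open>For \<open>p > 3\<close> take \<open>q = 1\<close>, where the last factor is 3 and
  cancels. For \<open>p = 3\<close> the only triple is \<open>(1, 1, 1)\<close>, and 1 agrees with
  -2 modulo 3.\<close>

lemma triple_sum_prime_cong:
  assumes "odd p"
  shows "rat_cong p 1 (triple_sum p p) (- 2 * bernoulli (p - 3))"
proof (cases "p = 3")
  case True
  have "coprime_triples 3 3 = {(1, 1, 1)}"
    by (auto simp: coprime_triples_def coprimes_def)
  then have "triple_sum p p = 1" by (simp add: triple_sum_def True)
  then show ?thesis by (intro rat_congI[OF p_integral_1]) (simp add: True)
next
  case False
  have "p \<noteq> 2" "p \<noteq> 1" "p \<noteq> 0" using assms prime_p by auto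
  then have p: "3 < p" using False by linarith
  have "\<not> p dvd 1" using p by auto
  then have "rat_cong p 1 (of_nat 3 * triple_sum p p) (of_nat 3 * (- 2 * bernoulli (p - 3)))"
    using triple_sum_cong[OF p, of 1] coprime_triples_multiple_sum[of 1]
    by (simp add: triple_sum_def)
  moreover have "\<not> p dvd 3" using p by (auto dest: dvd_imp_le)
  ultimately show ?thesis by (rule rat_cong_cancel)
qed

text \<open>For \<open>p = 3\<close> both sides vanish modulo 3: the left by its factor 3, the right
  because \<open>q ^ 2\<close> is congruent to 1 and \<open>bernoulli 0 = 1\<close>.\<close>

lemma coprime_triples_multiple_cong:
  assumes "odd p" "\<not> p dvd q"
  shows "rat_cong p 1
    (3 * (\<Sum>(i, j, k)\<in>coprime_triples (q * p) p. if q dvd i then 1 / (of_nat i * of_nat j * of_nat k) else 0))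
    (- 2 * bernoulli (p - 3) * (2 + 1 / of_nat q ^ 2))" (is "rat_cong p 1 (3 * ?G) _")
proof (cases "p = 3")
  case False
  have "p \<noteq> 2" "p \<noteq> 1" "p \<noteq> 0" using assms prime_p by auto
  then have "3 < p" using False by linarith
  from triple_sum_cong[OF this assms(2)] show ?thesis
    unfolding coprime_triples_multiple_sum[OF assms(2)] .
next
  case True
  have "?G \<in> p_integral p"
    by (rule p_integral_sum_coprime_triples) (simp add: p_integral_inverse_triple[OF dvd_refl])
  then have "rat_cong p 1 (3 * ?G) 0" using rat_cong_0I[of ?G 1] by (simp add: True)
  also have "rat_cong p 1 0 (- 2 * (2 + 1))" by (rule rat_congI[of 2, OF p_integral_numeral]) (simp add: True)
  also have "rat_cong p 1 (- 2 * (2 + 1)) (- 2 * (2 + 1 / of_nat q ^ 2))"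
    using power_cong_inverse[OF assms(2), of 2]
    by (intro rat_cong_mult_left rat_cong_add rat_cong_refl p_integral_neg_numeral) (simp add: True)
  finally show ?thesis by (simp add: True)
qed

text \<open>Inclusion-exclusion over the entries divisible by \<open>q\<close>. Since
  \<open>q\<close> divides the total, two such entries force the third; the pairwise intersections
  all equal the triple one, with net coefficient \<open>3 - 1 = 2\<close>.\<close>

lemma triple_sum_prime_mult_prime_cong:
  assumes "odd p" "prime q" "p \<noteq> q"
  shows "rat_cong p 1 (triple_sum (q * p) (q * p))
    (- 2 * ((of_nat q - 2) * (1 - 1 / of_nat q ^ 3)) * bernoulli (p - 3))"
proof -
  let ?B = "bernoulli (p - 3)" and ?T = "coprime_triples (q * p) p"
  let ?f = "\<lambda>i j k. 1 / (of_nat i * of_nat j * of_nat k) :: rat"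
  let ?G = "\<Sum>(i, j, k)\<in>?T. if q dvd i then ?f i j k else 0"
  let ?H = "\<Sum>(i, j, k)\<in>?T. if q dvd i \<and> q dvd j then ?f i j k else 0"
  have not_dvd: "\<not> p dvd q" using assms(2,3) prime_p primes_dvd_imp_eq by blast
  have cop: "coprime q p" using prime_imp_coprime[OF prime_p not_dvd] by (simp add: coprime_commute)
  have q_pos: "0 < q" using assms(2) prime_gt_0_nat by blast
  have coprime_q: "coprime i q \<longleftrightarrow> \<not> q dvd i" for i
    using assms(2) by (metis coprime_commute prime_imp_coprime coprime_absorb_left not_prime_unit)
  have G1: "(\<Sum>(i, j, k)\<in>?T. if q dvd j then ?f i j k else 0) = ?G"
    using sum_coprime_triples_swap(1)[of "\<lambda>i j k. if q dvd i then ?f i j k else 0" "q * p" p]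
    by (simp add: mult_ac split_def cong: if_cong)
  have G2: "(\<Sum>(i, j, k)\<in>?T. if q dvd k then ?f i j k else 0) = ?G"
    using sum_coprime_triples_swap(2)[of "\<lambda>i j k. if q dvd i then ?f i j k else 0" "q * p" p]
    by (simp add: mult_ac split_def cong: if_cong)
  have "triple_sum (q * p) (q * p) = (\<Sum>(i, j, k)\<in>?T. if q dvd i \<or> q dvd j \<or> q dvd k then 0 else ?f i j k)"
    unfolding triple_sum_def
    by (rule sum.mono_neutral_cong_left[OF finite_coprime_triples])
      (auto simp: coprime_triples_def coprimes_def coprime_q)
  also have "\<dots> = (\<Sum>(i, j, k)\<in>?T. ?f i j k - (if q dvd i then ?f i j k else 0)
      - (if q dvd j then ?f i j k else 0) - (if q dvd k then ?f i j k else 0)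
      + 2 * (if q dvd i \<and> q dvd j then ?f i j k else 0))"
  proof (intro sum.cong refl)
    fix t assume "t \<in> ?T"
    then obtain i j k where t: "t = (i, j, k)" "i + j + k = q * p"
      by (auto simp: coprime_triples_def)
    have "q dvd i + j + k" unfolding t(2) by simp
    then have "q dvd k" if "q dvd i" "q dvd j"
      using that by (simp add: dvd_add_right_iff)
    moreover have "q dvd j" if "q dvd i" "q dvd k"
      using that \<open>q dvd i + j + k\<close> by (simp add: dvd_add_right_iff dvd_add_left_iff)
    moreover have "q dvd i" if "q dvd j" "q dvd k"
      using that \<open>q dvd i + j + k\<close> by (simp add: dvd_add_left_iff)
    ultimately show "(case t of (i, j, k) \<Rightarrow> if q dvd i \<or> q dvd j \<or> q dvd k then 0 else ?f i j k)
      = (case t of (i, j, k) \<Rightarrow> ?f i j k - (if q dvd i then ?f i j k else 0)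
      - (if q dvd j then ?f i j k else 0) - (if q dvd k then ?f i j k else 0)
      + 2 * (if q dvd i \<and> q dvd j then ?f i j k else 0))"
      unfolding t(1) by auto
  qed
  also have "\<dots> = triple_sum (q * p) p - ?G - (\<Sum>(i, j, k)\<in>?T. if q dvd j then ?f i j k else 0)
      - (\<Sum>(i, j, k)\<in>?T. if q dvd k then ?f i j k else 0) + 2 * ?H"
    by (simp only: triple_sum_def split_def sum.distrib sum_subtractf sum_distrib_left)
  also have "\<dots> = triple_sum (q * p) p - 3 * ?G + 2 * (triple_sum p p / of_nat q ^ 3)"
    unfolding G1 G2 triple_sum_multiples[OF cop q_pos] by simp
  finally have decomposition: "triple_sum (q * p) (q * p)
      = triple_sum (q * p) p - 3 * ?G + 2 * (triple_sum p p / of_nat q ^ 3)" .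
  \<comment> \<open>The total \<open>p\<close> is multiplied by \<open>q\<close> while coprimality
    to \<open>p\<close> alone is kept.\<close>
  have first: "rat_cong p 1 (triple_sum (q * p) p) (of_nat q * (- 2 * ?B))"
    using rat_cong_trans[OF triple_sum_mult_cong_weak[of p p 1 q]
        rat_cong_mult_left[OF triple_sum_prime_cong[OF assms(1)], of "of_nat q"]]
      prime_gt_0_nat[OF prime_p] by simp
  have "\<not> p dvd q ^ 3" using prime_dvd_power[OF prime_p] not_dvd by blast
  from rat_cong_mult_left[OF triple_sum_prime_cong[OF assms(1)] p_integral_inverse[OF this]]
  have third: "rat_cong p 1 (triple_sum p p / of_nat q ^ 3) (- 2 * ?B / of_nat q ^ 3)"
    by simp
  have "rat_cong p 1 (triple_sum (q * p) (q * p))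
      (of_nat q * (- 2 * ?B) - (- 2 * ?B * (2 + 1 / of_nat q ^ 2)) + 2 * (- 2 * ?B / of_nat q ^ 3))"
    unfolding decomposition
    by (intro rat_cong_add rat_cong_diff rat_cong_mult_left[OF third] first
        coprime_triples_multiple_cong assms(1) not_dvd p_integral_numeral)
  \<comment> \<open>Without the common factor \<open>- 2 * ?B\<close> this is
    \<open>q - 2 - 1 / q ^ 2 + 2 / q ^ 3 = (q - 2) * (1 - 1 / q ^ 3)\<close>.\<close>
  also have "of_nat q * (- 2 * ?B) - (- 2 * ?B * (2 + 1 / of_nat q ^ 2)) + 2 * (- 2 * ?B / of_nat q ^ 3)
      = - 2 * ((of_nat q - 2) * (1 - 1 / of_nat q ^ 3)) * ?B"
    using q_pos by (simp add: field_simps eval_nat_numeral)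
  finally show ?thesis .
qed

section \<open>Reduction from prime powers to primes\<close>

text \<open>Each further factor \<open>p\<close> of the total raises the modulus by one power, by
  the strong congruence. The factors \<open>q\<close> are removed modulo \<open>p\<close> only,
  which suffices because that result is multiplied by \<open>p ^ (\<alpha> - 1)\<close>.\<close>

lemma triple_sum_prime_powers_cong:
  assumes "prime q" "p \<noteq> q" "\<alpha> > 0" "\<beta> > 0"
  shows "rat_cong p \<alpha> (triple_sum (p ^ \<alpha> * q ^ \<beta>) (q * p))
    (of_nat p ^ (\<alpha> - 1) * (of_nat q ^ (\<beta> - 1) * triple_sum (q * p) (q * p)))"
proof -
  have pos: "0 < p" "0 < q" using prime_p assms(1) prime_gt_0_nat by blast+
  have in_q: "rat_cong p 1 (triple_sum (p * q ^ Suc b) (q * p)) (of_nat q ^ b * triple_sum (q * p) (q * p))" for b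
  proof (induction b)
    case (Suc b)
    have "rat_cong p 1 (triple_sum (q * (p * q ^ Suc b)) (q * p)) (of_nat q * triple_sum (p * q ^ Suc b) (q * p))"
      using pos by (intro triple_sum_mult_cong_weak) (auto simp: mult_dvd_mono)
    also have "rat_cong p 1 \<dots> (of_nat q * (of_nat q ^ b * triple_sum (q * p) (q * p)))"
      by (intro rat_cong_mult_left Suc p_integral_of_nat)
    finally show ?case by (simp add: mult_ac)
  qed (simp add: mult.commute)
  have in_p: "rat_cong p (Suc a) (triple_sum (p ^ Suc a * q ^ Suc b) (q * p))
      (of_nat p ^ a * triple_sum (p * q ^ Suc b) (q * p))" for a b
  proof (induction a)
    case (Suc a)
    have "rat_cong p (Suc a + 1) (triple_sum (p * (p ^ Suc a * q ^ Suc b)) (q * p))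
        (of_nat p * triple_sum (p ^ Suc a * q ^ Suc b) (q * p))"
      using pos by (intro triple_sum_mult_cong_strong) (auto simp: mult_ac)
    also have "rat_cong p (Suc a + 1) \<dots> (of_nat p * (of_nat p ^ a * triple_sum (p * q ^ Suc b) (q * p)))"
      using rat_cong_scale[OF Suc, of 1] by (simp only: power_one_right)
    finally show ?case by (simp add: mult_ac)
  qed simp
  obtain a b where ab: "\<alpha> = Suc a" "\<beta> = Suc b" using assms(3,4) by (metis gr0_implies_Suc)
  have "rat_cong p (Suc a) (of_nat p ^ a * triple_sum (p * q ^ Suc b) (q * p))
      (of_nat p ^ a * (of_nat q ^ b * triple_sum (q * p) (q * p)))"
    using rat_cong_scale[OF in_q[of b], of a] by simp
  from rat_cong_trans[OF in_p this] show ?thesis by (simp only: ab diff_Suc_1)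
qed

end

theorem theorem1:
  fixes p q \<alpha> \<beta> :: nat
  assumes "prime p" and "odd p" and "prime q" and "odd q" and "p \<noteq> q"
    and "\<alpha> > 0" and "\<beta> > 0"
  shows "rat_cong p \<alpha>
           (\<Sum>(i, j, k)\<in>coprime_triples (2 * p ^ \<alpha> * q ^ \<beta>) (p * q).
              (-1) ^ i / (of_nat i * of_nat j * of_nat k))
           (- (1 / 2) * Z (p ^ \<alpha> * q ^ \<beta>))
       \<and> rat_cong p \<alpha>
           (- (1 / 2) * Z (p ^ \<alpha> * q ^ \<beta>))
           ((of_nat q - 2) * (1 - 1 / of_nat q ^ 3)
              * of_nat p ^ (\<alpha> - 1) * of_nat q ^ (\<beta> - 1) * bernoulli (p - 3))"
proof -
  interpret prime_modulus p by unfold_locales (rule assms(1))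
  define n where "n = p ^ \<alpha> * q ^ \<beta>"
  let ?S = "\<Sum>(i, j, k)\<in>coprime_triples (2 * n) (q * p). (-1) ^ i / (of_nat i * of_nat j * of_nat k) :: rat"
  \<comment> \<open>Both exponents are positive, so \<open>n\<close> and \<open>q * p\<close> have
    the same prime divisors.\<close>
  have "coprimes n = coprimes (q * p)"
    using assms(6,7) by (auto simp: n_def coprimes_def)
  then have Z_eq: "Z n = triple_sum n (q * p)"
    by (simp add: Z_def triple_sum_def coprime_triples_def)
  have n_pos: "n > 0" using assms(1,3) by (simp add: n_def prime_gt_0_nat)
  have dvd: "p dvd q * p" "q * p dvd n" "p ^ \<alpha> dvd n"
    using assms(6,7) unfolding n_def by (auto simp: mult.commute[of q] intro!: mult_dvd_mono dvd_power)
  have Z: "rat_cong p \<alpha> (Z n) (of_nat p ^ (\<alpha> - 1) * (of_nat q ^ (\<beta> - 1) * triple_sum (q * p) (q * p)))"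
    using triple_sum_prime_powers_cong[OF assms(3,5,6,7)] unfolding Z_eq by (simp only: n_def)
  have "\<not> p dvd 2" using assms(1,2) primes_dvd_imp_eq[of p 2] by auto
  then have half: "- (1 / 2) \<in> p_integral p"
    using p_integral_uminus[OF p_integral_inverse[of 2]] by simp
  \<comment> \<open>With \<open>2 * Z n\<close> in place of the last sum the right-hand side is
    \<open>- (3 / 2) * Z n\<close>; it remains to cancel 3.\<close>
  have S3: "3 * ?S = Z n / 2 - triple_sum (2 * n) (q * p)"
    unfolding Z_eq using assms(2,4) by (intro alternating_triple_sum) simp
  have "rat_cong p \<alpha> ?S (- (1 / 2) * Z n)"
  proof (cases "p = 3")
    case True
    \<comment> \<open>For \<open>p = 3\<close>, cancelling 3 costs one power of \<open>p\<close>,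
      which the strong congruence supplies in advance.\<close>
    have "rat_cong p (\<alpha> + 1) (triple_sum (2 * n) (q * p)) (of_nat 2 * Z n)"
      unfolding Z_eq by (rule triple_sum_mult_cong_strong[OF dvd n_pos assms(6)]) (simp add: True)
    then have "rat_cong p (\<alpha> + 1) (Z n / 2 - triple_sum (2 * n) (q * p)) (Z n / 2 - of_nat 2 * Z n)"
      by (intro rat_cong_diff rat_cong_refl)
    then have "rat_cong p (\<alpha> + 1) (of_nat p ^ 1 * ?S) (of_nat p ^ 1 * (- (1 / 2) * Z n))"
      unfolding S3[symmetric] using True by simp
    then show ?thesis by (rule rat_cong_unscale)
  next
    case False
    have "rat_cong p \<alpha> (Z n / 2 - triple_sum (2 * n) (q * p)) (Z n / 2 - of_nat 2 * Z n)"
      unfolding Z_eq by (intro rat_cong_diff rat_cong_refl triple_sum_mult_cong_weak dvd n_pos)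
    then have "rat_cong p \<alpha> (of_nat 3 * ?S) (of_nat 3 * (- (1 / 2) * Z n))"
      using S3 by simp
    moreover have "\<not> p dvd 3" using False assms(1) primes_dvd_imp_eq[of p 3] by auto
    ultimately show ?thesis by (rule rat_cong_cancel)
  qed
  moreover have "rat_cong p \<alpha> (- (1 / 2) * Z n)
      ((of_nat q - 2) * (1 - 1 / of_nat q ^ 3)
         * of_nat p ^ (\<alpha> - 1) * of_nat q ^ (\<beta> - 1) * bernoulli (p - 3))"
  proof -
    \<comment> \<open>The factor -2 is absorbed by \<open>- (1 / 2)\<close>, which is
      \<open>p\<close>-integral because \<open>p\<close> is odd.\<close>
    let ?c = "- 2 * ((of_nat q - 2) * (1 - 1 / of_nat q ^ 3)) * bernoulli (p - 3) :: rat"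
    have "rat_cong p 1 (of_nat q ^ (\<beta> - 1) * triple_sum (q * p) (q * p)) (of_nat q ^ (\<beta> - 1) * ?c)"
      by (intro rat_cong_mult_left triple_sum_prime_mult_prime_cong assms p_integral_power p_integral_of_nat)
    from rat_cong_scale[OF this, of "\<alpha> - 1"]
    have "rat_cong p \<alpha> (of_nat p ^ (\<alpha> - 1) * (of_nat q ^ (\<beta> - 1) * triple_sum (q * p) (q * p)))
        (of_nat p ^ (\<alpha> - 1) * (of_nat q ^ (\<beta> - 1) * ?c))"
      using assms(6) by simp
    from rat_cong_mult_left[OF rat_cong_trans[OF Z this] half]
    show ?thesis by (simp add: mult_ac)
  qed
  ultimately show ?thesis
    by (simp add: n_def mult.commute[of p q] mult.assoc)
qed

end
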